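(* Let $K=\{x\in\mathbb{R}^n : c_i(x)=0\ (i\in\mathcal{E}),\ c_j(x)\ge 0\ (j\in\mathcal{I})\}$ with polynomials $c_i,c_j\in\mathbb{R}[x]$, let $\mathcal{A}\subseteq\mathbb{N}^n$ be a finite set, and let $d=\deg(\mathcal{A})$. Suppose $K$ is closed at $\infty$ and $\mathbb{R}[x]_{\mathcal{A}}\cap int(\mathscr{P}_d(K))\ne\emptyset$. Then $$\bigcap_{k=1}^{\infty}\mathscr{R}^{(k)}(K)=cl(\mathscr{R}_{\mathcal{A}}(K)),$$ $$int(\mathscr{P}_{\mathcal{A}}(K))\subseteq\bigcup_{k=1}^{\infty}\mathscr{P}^{(k)}(K)\subseteq\mathscr{P}_{\mathcal{A}}(K),$$ where the intersection is understood over those orders $k$ with $2k\ge d$, for which the relaxation $\mathscr{R}^{(k)}(K)$ is defined.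
   Context: Notation: $x=(x_1,\dots,x_n)$, $\tilde{x}=(x_0,x)$. $\mathcal{E},\mathcal{I}$ are finite label sets. $\mathbb{R}[x]_d$ is the space of real polynomials in $x$ of degree $\le d$. $\mathbb{N}^{N}_{t}=\{\alpha\in\mathbb{N}^N:|\alpha|\le t\}$, $|\alpha|=\sum\alpha_i$. For a finite $\mathcal{A}\subseteq\mathbb{N}^n$, $\deg(\mathcal{A})=\max\{|\alpha|:\alpha\in\mathcal{A}\}$; $\mathbb{R}[x]_{\mathcal{A}}$ is the span of the monomials $x^\alpha$, $\alpha\in\mathcal{A}$; $\mathbb{R}^{\mathcal{A}}$ is the space of real vectors $(y_\alpha)_{\alpha\in\mathcal{A}}$. $\mathscr{P}_{\mathcal{A}}(K)=\{p\in\mathbb{R}[x]_{\mathcal{A}}:p\ge 0\text{ on }K\}$, $\mathscr{P}_d(K)=\{p\in\mathbb{R}[x]_d:p\ge 0\text{ on }K\}$, with interiors $int$ in $\mathbb{R}[x]_{\mathcal{A}}$ and $\mathbb{R}[x]_d$. $\mathscr{R}_{\mathcal{A}}(K)$ is the set of all $y\in\mathbb{R}^{\mathcal{A}}$ for which there is a positive Borel measure $\mu$ on $\mathbb{R}^n$ with support contained in $K$ and $y_\alpha=\int x^\alpha\,d\mu$ for all $\alpha\in\mathcal{A}$ (the zero measure is allowed). For a polynomial $p$, $\tilde{p}(\tilde{x})=x_0^{\deg(p)}p(x/x_0)$ is its homogenization. Define $\widetilde{K}^h=\{\tilde{x}\in\mathbb{R}^{n+1}:\tilde{c}_i(\tilde{x})=0\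 (i\in\mathcal{E}),\ \tilde{c}_j(\tilde{x})\ge 0\ (j\in\mathcal{I}),\ x_0\ge 0\}$ and $\widetilde{K}^c=\widetilde{K}^h\cap\{x_0>0\}$. $K$ (with its describing polynomials) is closed at $\infty$ if $cl(\widetilde{K}^c)=\widetilde{K}^h$, where $cl$ is the Euclidean closure. The homogenization of $\mathcal{A}$ is $\tilde{\mathcal{A}}=\{(d-|\alpha|,\alpha):\alpha\in\mathcal{A}\}\subseteq\mathbb{N}^{n+1}$, and for $y\in\mathbb{R}^{\mathcal{A}}$, $\tilde{y}\in\mathbb{R}^{\tilde{\mathcal{A}}}$ is given by $\tilde{y}_{(d-|\alpha|,\alpha)}=y_\alpha$. $w|_{\tilde{\mathcal{A}}}$ is the subvector of $w$ with labels in $\tilde{\mathcal{A}}$. For $w\in\mathbb{R}^{\mathbb{N}^{n+1}_{2k}}$, $\mathscr{L}_w$ is the linear functional on polynomials of degree $\le 2k$ sending each monomial $\tilde{x}^\beta$ to $w_\beta$. For a polynomial $q$, the localizing matrix $L_q^{(k)}[w]$ is the symmetric matrix such that $\mathscr{L}_w(qp^2)=\mathit{vec}(p)^T L_q^{(k)}[w]\,\mathit{vec}(p)$ for all $p\in\mathbb{R}[\tilde{x}]$ with $\deg(qp^2)\le 2k$, where $\mathit{vec}(p)$ is the coefficient vector (constraints on $L_q^{(k)}[w]$ are vacuous if $\deg q>2k$); $M_k[w]=L_1^{(k)}[w]$. The $k$th order relaxation of $\mathscr{R}_{\mathcal{A}}(K)$ is the set $\mathscr{R}^{(k)}(K)$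 of all $y\in\mathbb{R}^{\mathcal{A}}$ for which there exists $w\in\mathbb{R}^{\mathbb{N}^{n+1}_{2k}}$ with $\tilde{y}=w|_{\tilde{\mathcal{A}}}$, $L^{(k)}_{\tilde{c}_i}[w]=0\ (i\in\mathcal{E})$, $L^{(k)}_{\|\tilde{x}\|^2-1}[w]=0$, $L^{(k)}_{\tilde{c}_j}[w]\succeq 0\ (j\in\mathcal{I})$, $L^{(k)}_{x_0}[w]\succeq 0$, $M_k[w]\succeq 0$. Let $\tilde{c}_{eq}=(\tilde{c}_i)_{i\in\mathcal{E}}\cup\{\|\tilde{x}\|^2-1\}$ and $\tilde{c}_{in}=(\tilde{c}_j)_{j\in\mathcal{I}}\cup\{x_0\}$. For $h=(h_1,\dots,h_t)$ and $g=(g_1,\dots,g_\ell)$, $\mathrm{Ideal}[h]_{2k}=\sum_i h_i\,\mathbb{R}[\tilde{x}]_{2k-\deg(h_i)}$ and $\mathrm{QM}[g]_{2k}=\Sigma[\tilde{x}]_{2k}+\sum_j g_j\,\Sigma[\tilde{x}]_{2k-2\lceil\deg(g_j)/2\rceil}$, where $\Sigma[\tilde{x}]_{s}$ is the set of sums of squares of polynomials having degree $\le s$ (terms with negative subscript are $\{0\}$). The $k$th order SOS approximation of $\mathscr{P}_{\mathcal{A}}(K)$ is $$\mathscr{P}^{(k)}(K)=\{p\in\mathbb{R}[x]_{\mathcal{A}}:\tilde{p}\in\mathrm{Ideal}[\tilde{c}_{eq}]_{2k}+\mathrm{QM}[\tilde{c}_{in}]_{2k}\}.$$ *)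

theory Defs
  imports "HOL-Analysis.Analysis" "HOL-Library.Poly_Mapping"
begin

section \<open>Polynomials in finitely many variables\<close>

text \<open>
  Exponents are finitely supported maps \<open>'v \<Rightarrow>\<^sub>0 nat\<close> and real polynomials are finitely
  supported maps from exponents to coefficients, for a finite type \<open>'v\<close> of variables.
  The ambient space of \<open>x = (x\<^sub>1, \<dots>, x\<^sub>n)\<close> is \<open>real ^ 'n\<close>; for the homogeneous coordinates
  \<open>(x\<^sub>0, x)\<close> the variable type is \<open>'n option\<close>, where \<open>None\<close> is the label of \<open>x\<^sub>0\<close>.
\<close>

type_synonym 'v expo = "'v \<Rightarrow>\<^sub>0 nat"
type_synonym 'v rpoly = "'v expo \<Rightarrow>\<^sub>0 real"

abbreviation "lookup \<equiv> Poly_Mapping.lookup"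
abbreviation "keys \<equiv> Poly_Mapping.keys"

definition mdeg :: "'v::finite expo \<Rightarrow> nat" where
  "mdeg \<alpha> = (\<Sum>i\<in>UNIV. lookup \<alpha> i)"

definition set_deg :: "'v::finite expo set \<Rightarrow> nat" where
  "set_deg A = (if A = {} then 0 else Max (mdeg ` A))"

text \<open>The empty set of exponents, and hence the zero polynomial, has degree 0.\<close>

definition pdeg :: "'v::finite rpoly \<Rightarrow> nat" where
  "pdeg p = set_deg (keys p)"

definition expos_upto :: "nat \<Rightarrow> 'v::finite expo set" where
  "expos_upto t = {\<alpha>. mdeg \<alpha> \<le> t}"

definition monom_eval :: "'v::finite expo \<Rightarrow> real ^ 'v \<Rightarrow> real" where
  "monom_eval \<alpha> x = (\<Prod>i\<in>UNIV. (x $ i) ^ lookup \<alpha> i)"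

definition peval :: "'v::finite rpoly \<Rightarrow> real ^ 'v \<Rightarrow> real" where
  "peval p x = (\<Sum>\<alpha>\<in>keys p. lookup p \<alpha> * monom_eval \<alpha> x)"

definition pvar :: "'v::finite \<Rightarrow> 'v rpoly" where
  "pvar i = Poly_Mapping.single (Poly_Mapping.single i 1) 1"

definition polys_on :: "'v::finite expo set \<Rightarrow> 'v rpoly set" where
  "polys_on A = {p. keys p \<subseteq> A}"

text \<open>The bound is an integer, and a negative bound leaves only the zero polynomial.\<close>

definition polys_upto :: "int \<Rightarrow> 'v::finite rpoly set" where
  "polys_upto s = {p. p = 0 \<or> int (pdeg p) \<le> s}"

definition sos_upto :: "int \<Rightarrow> 'v::finite rpoly set" where
  "sos_upto s = {\<sigma> \<in> polys_upto s. \<exists>qs. \<sigma> = (\<Sum>q\<leftarrow>qs. q\<^sup>2)}"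

text \<open>
  Here \<open>euclidean\<close> is the product topology on coefficient functions, so this is the topology
  of coefficientwise convergence on a space \<open>V\<close> of polynomials.
  If \<open>V\<close> is finite-dimensional, then it is the Euclidean topology of \<open>V\<close>.
\<close>

definition poly_topology :: "'v::finite rpoly set \<Rightarrow> 'v rpoly topology" where
  "poly_topology V = pullback_topology V lookup euclidean"

definition nonneg_polys :: "'v::finite rpoly set \<Rightarrow> (real ^ 'v) set \<Rightarrow> 'v rpoly set" where
  "nonneg_polys V K = {p \<in> V. \<forall>x\<in>K. 0 \<le> peval p x}"


section \<open>The moment cone\<close>

text \<open>
  For a set \<open>B\<close> of labels, \<open>\<real>\<^sup>B\<close> is rendered as the extensional functions \<open>B \<rightarrow>\<^sub>E UNIV\<close> with
  the product topology.
\<close>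

definition measure_support :: "'a::topological_space measure \<Rightarrow> 'a set" where
  "measure_support M = {x. \<forall>U. open U \<and> x \<in> U \<longrightarrow> emeasure M U \<noteq> 0}"

definition moment_cone ::
  "'n::finite expo set \<Rightarrow> (real ^ 'n) set \<Rightarrow> ('n expo \<Rightarrow> real) set" where
  "moment_cone A K = {y \<in> A \<rightarrow>\<^sub>E UNIV. \<exists>M :: (real ^ 'n) measure.
     sets M = sets borel \<and> measure_support M \<subseteq> K \<and>
     (\<forall>\<alpha>\<in>A. has_bochner_integral M (monom_eval \<alpha>) (y \<alpha>))}"


section \<open>Homogenization\<close>

definition hom_expo :: "nat \<Rightarrow> 'n::finite expo \<Rightarrow> 'n option expo" where
  "hom_expo d \<alpha> = Abs_poly_mapping (\<lambda>v. case v of None \<Rightarrow> d - mdeg \<alpha> | Some i \<Rightarrow> lookup \<alpha> i)"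

definition homogenize :: "'n::finite rpoly \<Rightarrow> 'n option rpoly" where
  "homogenize p = (\<Sum>\<alpha>\<in>keys p. Poly_Mapping.single (hom_expo (pdeg p) \<alpha>) (lookup p \<alpha>))"

definition semialg :: "('l \<Rightarrow> 'n::finite rpoly) \<Rightarrow> 'l set \<Rightarrow> 'l set \<Rightarrow> (real ^ 'n) set" where
  "semialg c E I = {x. (\<forall>i\<in>E. peval (c i) x = 0) \<and> (\<forall>j\<in>I. 0 \<le> peval (c j) x)}"

definition hom_set ::
  "('l \<Rightarrow> 'n::finite rpoly) \<Rightarrow> 'l set \<Rightarrow> 'l set \<Rightarrow> (real ^ 'n option) set" where
  "hom_set c E I = {x. (\<forall>i\<in>E. peval (homogenize (c i)) x = 0) \<and>
     (\<forall>j\<in>I. 0 \<le> peval (homogenize (c j)) x) \<and> 0 \<le> x $ None}"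

definition closed_at_infinity ::
  "('l \<Rightarrow> 'n::finite rpoly) \<Rightarrow> 'l set \<Rightarrow> 'l set \<Rightarrow> bool" where
  "closed_at_infinity c E I \<longleftrightarrow>
     closure (hom_set c E I \<inter> {x. x $ None > 0}) = hom_set c E I"


section \<open>Moment relaxations\<close>

definition riesz :: "('v::finite expo \<Rightarrow> real) \<Rightarrow> 'v rpoly \<Rightarrow> real" where
  "riesz w f = (\<Sum>\<beta>\<in>keys f. lookup f \<beta> * w \<beta>)"

text \<open>
  The row and column labels of the \<open>k\<close>-th localizing matrix of \<open>q\<close>. The set is empty
  if \<open>deg q > 2 k\<close>.
\<close>

definition loc_index :: "nat \<Rightarrow> 'v::finite rpoly \<Rightarrow> 'v expo set" where
  "loc_index k q = {\<beta>. pdeg q + 2 * mdeg \<beta> \<le> 2 * k}"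

text \<open>
  If \<open>q \<noteq> 0\<close> and \<open>deg (q p\<^sup>2) \<le> 2 k\<close>, then all exponents of \<open>p\<close> are in \<open>loc_index k q\<close>, so that
  the double sum below is \<open>vec(p)\<^sup>T M vec(p)\<close>.
  Lemma \<open>loc_mat_unique\<close> shows that the matrix is uniquely determined, and \<open>loc_mat_eq\<close> gives
  its entries.
\<close>

definition is_loc_mat ::
  "nat \<Rightarrow> 'v::finite rpoly \<Rightarrow> ('v expo \<Rightarrow> real) \<Rightarrow> ('v expo \<times> 'v expo \<Rightarrow> real) \<Rightarrow> bool" where
  "is_loc_mat k q w M \<longleftrightarrow>
     M \<in> loc_index k q \<times> loc_index k q \<rightarrow>\<^sub>E UNIV \<and>
     (\<forall>\<beta>\<in>loc_index k q. \<forall>\<gamma>\<in>loc_index k q. M (\<beta>, \<gamma>) = M (\<gamma>, \<beta>)) \<and>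
     (\<forall>p. pdeg (q * p\<^sup>2) \<le> 2 * k \<longrightarrow>
        riesz w (q * p\<^sup>2) =
          (\<Sum>\<beta>\<in>loc_index k q. \<Sum>\<gamma>\<in>loc_index k q. lookup p \<beta> * M (\<beta>, \<gamma>) * lookup p \<gamma>))"

definition loc_mat ::
  "nat \<Rightarrow> 'v::finite rpoly \<Rightarrow> ('v expo \<Rightarrow> real) \<Rightarrow> 'v expo \<times> 'v expo \<Rightarrow> real" where
  "loc_mat k q w = (THE M. is_loc_mat k q w M)"

definition loc_zero :: "nat \<Rightarrow> 'v::finite rpoly \<Rightarrow> ('v expo \<Rightarrow> real) \<Rightarrow> bool" where
  "loc_zero k q w \<longleftrightarrow>
     (\<forall>\<beta>\<in>loc_index k q. \<forall>\<gamma>\<in>loc_index k q. loc_mat k q w (\<beta>, \<gamma>) = 0)"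

definition loc_psd :: "nat \<Rightarrow> 'v::finite rpoly \<Rightarrow> ('v expo \<Rightarrow> real) \<Rightarrow> bool" where
  "loc_psd k q w \<longleftrightarrow>
     (\<forall>v :: 'v expo \<Rightarrow> real.
        0 \<le> (\<Sum>\<beta>\<in>loc_index k q. \<Sum>\<gamma>\<in>loc_index k q. v \<beta> * loc_mat k q w (\<beta>, \<gamma>) * v \<gamma>))"

definition sphere_poly :: "'v::finite rpoly" where
  "sphere_poly = (\<Sum>i\<in>UNIV. (pvar i)\<^sup>2) - 1"

text \<open>
  With \<open>d = deg A\<close>, the clause on \<open>hom_expo\<close> says that \<open>w\<close> restricts to the homogenized
  vector of \<open>y\<close>. The definition is meant for \<open>2 k \<ge> d\<close>, where these labels occur in \<open>w\<close>.
\<close>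

definition relaxation ::
  "('l \<Rightarrow> 'n::finite rpoly) \<Rightarrow> 'l set \<Rightarrow> 'l set \<Rightarrow> 'n expo set \<Rightarrow> nat \<Rightarrow> ('n expo \<Rightarrow> real) set" where
  "relaxation c E I A k = {y \<in> A \<rightarrow>\<^sub>E UNIV.
     \<exists>w \<in> (expos_upto (2 * k) :: 'n option expo set) \<rightarrow>\<^sub>E UNIV.
       (\<forall>\<alpha>\<in>A. w (hom_expo (set_deg A) \<alpha>) = y \<alpha>) \<and>
       (\<forall>i\<in>E. loc_zero k (homogenize (c i)) w) \<and>
       loc_zero k sphere_poly w \<and>
       (\<forall>j\<in>I. loc_psd k (homogenize (c j)) w) \<and>
       loc_psd k (pvar None) w \<and>
       loc_psd k 1 w}"


section \<open>Sum-of-squares approximations\<close>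

text \<open>
  The generators are given as finite sets. Repetitions in a tuple of generators would not
  change the truncated ideal or quadratic module, as the sets of multipliers are closed
  under addition.
\<close>

definition trunc_ideal :: "nat \<Rightarrow> 'v::finite rpoly set \<Rightarrow> 'v rpoly set" where
  "trunc_ideal k H = {\<Sum>h\<in>H. h * u h | u.
     \<forall>h\<in>H. u h \<in> polys_upto (2 * int k - int (pdeg h))}"

definition trunc_qm :: "nat \<Rightarrow> 'v::finite rpoly set \<Rightarrow> 'v rpoly set" where
  "trunc_qm k G = {s0 + (\<Sum>g\<in>G. g * s g) | s0 s.
     s0 \<in> sos_upto (2 * int k) \<and>
     (\<forall>g\<in>G. s g \<in> sos_upto (2 * int k - 2 * \<lceil>real (pdeg g) / 2\<rceil>))}"

definition sos_approx ::
  "('l \<Rightarrow> 'n::finite rpoly) \<Rightarrow> 'l set \<Rightarrow> 'l set \<Rightarrow> 'n expo set \<Rightarrow> nat \<Rightarrow> 'n rpoly set" where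
  "sos_approx c E I A k = {p \<in> polys_on A. \<exists>f g.
     f \<in> trunc_ideal k (insert sphere_poly ((\<lambda>i. homogenize (c i)) ` E)) \<and>
     g \<in> trunc_qm k (insert (pvar None) ((\<lambda>j. homogenize (c j)) ` I)) \<and>
     homogenize p = f + g}"

section \<open>Basic properties\<close>

lemma lookup_hom_expo [simp]:
  fixes \<alpha> :: "'n::finite expo"
  shows "lookup (hom_expo d \<alpha>) None = d - mdeg \<alpha>"
    and "lookup (hom_expo d \<alpha>) (Some i) = lookup \<alpha> i"
  by (simp_all add: hom_expo_def)

lemma mdeg_le_set_deg: "finite A \<Longrightarrow> \<alpha> \<in> A \<Longrightarrow> mdeg \<alpha> \<le> set_deg A"
  by (auto simp: set_deg_def)

lemma mdeg_le_pdeg: "\<alpha> \<in> keys p \<Longrightarrow> mdeg \<alpha> \<le> pdeg p"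
  by (simp add: pdeg_def mdeg_le_set_deg)

lemma pdeg_le_iff: "pdeg p \<le> m \<longleftrightarrow> (\<forall>\<alpha>\<in>keys p. mdeg \<alpha> \<le> m)"
  by (auto simp: pdeg_def set_deg_def)

lemma pdeg_zero [simp]: "pdeg 0 = 0"
  by (simp add: pdeg_def set_deg_def)

lemma mdeg_add: "mdeg (\<alpha> + \<beta>) = mdeg \<alpha> + mdeg \<beta>"
  by (simp add: mdeg_def lookup_add sum.distrib)

lemma hom_expo_inject: "hom_expo d \<alpha> = hom_expo e \<beta> \<Longrightarrow> \<alpha> = \<beta>"
  by (metis lookup_hom_expo(2) poly_mapping_eqI)

lemma peval_superset:
  assumes "finite S" "keys p \<subseteq> S"
  shows "peval p x = (\<Sum>\<alpha>\<in>S. lookup p \<alpha> * monom_eval \<alpha> x)"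
  unfolding peval_def using assms
  by (intro sum.mono_neutral_left) (auto simp: in_keys_iff)

lemma UNIV_option_prod:
  fixes f :: "'n::finite option \<Rightarrow> real"
  shows "(\<Prod>v\<in>UNIV. f v) = f None * (\<Prod>i\<in>UNIV. f (Some i))"
  by (simp add: UNIV_option_conv prod.reindex)

lemma peval_homogenize:
  fixes p :: "'n::finite rpoly" and x :: "real ^ 'n option"
  assumes "x $ None \<noteq> 0"
  shows "peval (homogenize p) x =
    (x $ None) ^ pdeg p * peval p (\<chi> i. x $ Some i / x $ None)"
proof -
  let ?h = "hom_expo (pdeg p)"
  let ?S = "?h ` keys p"
  have inj: "inj_on ?h (keys p)"
    by (auto simp: inj_on_def dest: hom_expo_inject)
  have coeff: "lookup (homogenize p) (?h \<alpha>) = lookup p \<alpha>" if "\<alpha> \<in> keys p" for \<alpha>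
  proof -
    have "lookup (homogenize p) (?h \<alpha>) =
        (\<Sum>\<beta>\<in>keys p. if \<beta> = \<alpha> then lookup p \<beta> else 0)"
      unfolding homogenize_def lookup_sum
      by (intro sum.cong) (auto simp: lookup_single when_def dest: hom_expo_inject)
    then show ?thesis using that by simp
  qed
  have keys: "keys (homogenize p) \<subseteq> ?S"
    unfolding homogenize_def
    by (rule order_trans[OF keys_sum]) (auto split: if_splits)
  have mono: "monom_eval (?h \<alpha>) x =
      (x $ None) ^ pdeg p * monom_eval \<alpha> (\<chi> i. x $ Some i / x $ None)"
    if "\<alpha> \<in> keys p" for \<alpha>
  proof -
    have "(x $ None) ^ pdeg p = (x $ None) ^ (pdeg p - mdeg \<alpha>) * (x $ None) ^ mdeg \<alpha>"
      using mdeg_le_pdeg[OF that] by (simp flip: power_add)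
    then show ?thesis using assms
      by (simp add: monom_eval_def UNIV_option_prod power_divide prod_dividef
          mdeg_def power_sum)
  qed
  have "peval (homogenize p) x =
      (\<Sum>\<alpha>\<in>keys p. lookup (homogenize p) (?h \<alpha>) * monom_eval (?h \<alpha>) x)"
    by (subst peval_superset[OF _ keys]) (auto simp: sum.reindex[OF inj])
  also have "\<dots> = (x $ None) ^ pdeg p * peval p (\<chi> i. x $ Some i / x $ None)"
    unfolding peval_def sum_distrib_left
    by (intro sum.cong refl) (simp add: coeff mono)
  finally show ?thesis .
qed

lemma finite_expos_upto: "finite (expos_upto t :: 'v::finite expo set)"
proof -
  have "lookup ` (expos_upto t :: 'v expo set) \<subseteq> UNIV \<rightarrow>\<^sub>E {..t}"
  proof -
    have "lookup \<alpha> i \<le> t" if "mdeg \<alpha> \<le> t" for \<alpha> :: "'v expo" and i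
    proof -
      have "lookup \<alpha> i \<le> mdeg \<alpha>"
        unfolding mdeg_def by (rule member_le_sum) auto
      then show ?thesis using that by simp
    qed
    then show ?thesis by (auto simp: expos_upto_def)
  qed
  then have "finite (lookup ` (expos_upto t :: 'v expo set))"
    by (rule finite_subset) (simp add: finite_PiE)
  then show ?thesis
    by (rule finite_imageD) (simp add: inj_on_def)
qed

lemma finite_loc_index [simp]: "finite (loc_index k q)"
  by (rule finite_subset[OF _ finite_expos_upto[of k]]) (auto simp: loc_index_def expos_upto_def)

lemma poly_sum_monomials:
  fixes p :: "'v::finite rpoly"
  assumes "finite S" "keys p \<subseteq> S"
  shows "p = (\<Sum>\<alpha>\<in>S. Poly_Mapping.single \<alpha> (lookup p \<alpha>))"
proof (rule poly_mapping_eqI)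
  fix \<beta>
  have "(\<Sum>\<alpha>\<in>S. lookup (Poly_Mapping.single \<alpha> (lookup p \<alpha>)) \<beta>) =
      (\<Sum>\<alpha>\<in>S. if \<alpha> = \<beta> then lookup p \<alpha> else 0)"
    by (intro sum.cong) (auto simp: lookup_single when_def)
  then show "lookup p \<beta> = lookup (\<Sum>\<alpha>\<in>S. Poly_Mapping.single \<alpha> (lookup p \<alpha>)) \<beta>"
    using assms by (auto simp: lookup_sum in_keys_iff)
qed

lemma poly_mult_monomials:
  fixes p q :: "'v::finite rpoly"
  assumes "finite S" "keys p \<subseteq> S" "finite T" "keys q \<subseteq> T"
  shows "p * q = (\<Sum>\<alpha>\<in>S. \<Sum>\<beta>\<in>T. Poly_Mapping.single (\<alpha> + \<beta>) (lookup p \<alpha> * lookup q \<beta>))"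
  by (subst poly_sum_monomials[OF assms(1,2)], subst poly_sum_monomials[OF assms(3,4)])
    (simp add: sum_product mult_single)

lemma pdeg_mult_le: "pdeg (p * q) \<le> pdeg p + pdeg q"
  unfolding pdeg_le_iff
proof
  fix \<gamma> assume "\<gamma> \<in> keys (p * q)"
  then obtain \<alpha> \<beta> where "\<gamma> = \<alpha> + \<beta>" "\<alpha> \<in> keys p" "\<beta> \<in> keys q"
    using keys_mult[of p q] by blast
  then show "mdeg \<gamma> \<le> pdeg p + pdeg q"
    by (simp add: mdeg_add add_mono mdeg_le_pdeg)
qed

lemma top_expo_exists:
  fixes p :: "'v::finite rpoly" and e :: "'v expo \<Rightarrow> nat \<Rightarrow>\<^sub>0 nat"
  assumes "p \<noteq> 0"
  obtains \<alpha> where "\<alpha> \<in> keys p" "mdeg \<alpha> = pdeg p"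
    "\<And>\<beta>. \<beta> \<in> keys p \<Longrightarrow> mdeg \<beta> = pdeg p \<Longrightarrow> e \<beta> \<le> e \<alpha>"
proof -
  let ?S = "{\<alpha>\<in>keys p. mdeg \<alpha> = pdeg p}"
  have "keys p \<noteq> {}" using assms by simp
  then have "pdeg p \<in> mdeg ` keys p"
    unfolding pdeg_def set_deg_def by (simp add: Max_in del: keys_eq_empty)
  then have ne: "?S \<noteq> {}" by force
  then have "Max (e ` ?S) \<in> e ` ?S" by (intro Max_in) auto
  then obtain \<alpha> where "\<alpha> \<in> ?S" "e \<alpha> = Max (e ` ?S)" by auto
  then show ?thesis by (intro that[of \<alpha>]) auto
qed

lemma pdeg_mult:
  fixes p q :: "'v::finite rpoly"
  assumes "p \<noteq> 0" "q \<noteq> 0"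
  shows "p * q \<noteq> 0" and "pdeg (p * q) = pdeg p + pdeg q"
proof -
  obtain f :: "'v \<Rightarrow> nat" where f: "inj f"
    using finite_imp_inj_to_nat_seg[of "UNIV :: 'v set"] by auto
  define e where "e \<alpha> = (\<Sum>i\<in>UNIV. Poly_Mapping.single (f i) (lookup \<alpha> i))" for \<alpha> :: "'v expo"
  have e_add: "e (\<alpha> + \<beta>) = e \<alpha> + e \<beta>" for \<alpha> \<beta>
    by (simp add: e_def lookup_add single_add sum.distrib)
  have lookup_e: "lookup (e \<alpha>) (f i) = lookup \<alpha> i" for \<alpha> i
  proof -
    have "lookup (e \<alpha>) (f i) = (\<Sum>j\<in>UNIV. if j = i then lookup \<alpha> j else 0)"
      unfolding e_def lookup_sum
      by (intro sum.cong) (auto simp: lookup_single when_def injD[OF f])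
    then show ?thesis by simp
  qed
  have e_inj: "\<alpha> = \<beta>" if "e \<alpha> = e \<beta>" for \<alpha> \<beta>
    by (rule poly_mapping_eqI) (metis lookup_e that)
  obtain \<alpha> where \<alpha>: "\<alpha> \<in> keys p" "mdeg \<alpha> = pdeg p"
    "\<And>\<beta>. \<beta> \<in> keys p \<Longrightarrow> mdeg \<beta> = pdeg p \<Longrightarrow> e \<beta> \<le> e \<alpha>"
    using top_expo_exists[OF assms(1)] by metis
  obtain \<beta> where \<beta>: "\<beta> \<in> keys q" "mdeg \<beta> = pdeg q"
    "\<And>\<gamma>. \<gamma> \<in> keys q \<Longrightarrow> mdeg \<gamma> = pdeg q \<Longrightarrow> e \<gamma> \<le> e \<beta>"
    using top_expo_exists[OF assms(2)] by metis
  have uniq: "a + b = \<alpha> + \<beta> \<longleftrightarrow> a = \<alpha> \<and> b = \<beta>" if ab: "a \<in> keys p" "b \<in> keys q" for a b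
  proof
    assume eq: "a + b = \<alpha> + \<beta>"
    have "mdeg a + mdeg b = pdeg p + pdeg q"
      using arg_cong[OF eq, of mdeg] \<alpha>(2) \<beta>(2) by (simp add: mdeg_add)
    then have "mdeg a = pdeg p" "mdeg b = pdeg q"
      using mdeg_le_pdeg[OF ab(1)] mdeg_le_pdeg[OF ab(2)] by linarith+
    then have le: "e a \<le> e \<alpha>" "e b \<le> e \<beta>"
      using \<alpha>(3) \<beta>(3) ab by auto
    have sum: "e a + e b = e \<alpha> + e \<beta>"
      using eq by (metis e_add)
    have "e a = e \<alpha>"
    proof (rule ccontr)
      assume "e a \<noteq> e \<alpha>"
      then have "e a < e \<alpha>" using le by simp
      then have "e a + e b < e \<alpha> + e \<beta>" using le(2) by (rule add_less_le_mono)
      then show False using sum by simp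
    qed
    then have "a = \<alpha>" by (rule e_inj)
    then show "a = \<alpha> \<and> b = \<beta>" using eq by simp
  qed simp
  have "lookup (p * q) (\<alpha> + \<beta>) =
      (\<Sum>a\<in>keys p. \<Sum>b\<in>keys q. if a = \<alpha> \<and> b = \<beta> then lookup p a * lookup q b else 0)"
    unfolding poly_mult_monomials[OF finite_keys subset_refl finite_keys subset_refl, of p q]
      lookup_sum
    by (intro sum.cong refl) (auto simp: lookup_single when_def uniq)
  also have "\<dots> = (\<Sum>a\<in>keys p. if a = \<alpha> then lookup p \<alpha> * lookup q \<beta> else 0)"
    using \<beta>(1) by (intro sum.cong refl) auto
  also have "\<dots> = lookup p \<alpha> * lookup q \<beta>"
    using \<alpha>(1) by simp
  finally have "\<alpha> + \<beta> \<in> keys (p * q)"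
    using \<alpha>(1) \<beta>(1) by (simp add: in_keys_iff)
  then show "p * q \<noteq> 0" "pdeg (p * q) = pdeg p + pdeg q"
    using mdeg_le_pdeg[of "\<alpha> + \<beta>" "p * q"] pdeg_mult_le[of p q] \<alpha>(2) \<beta>(2)
    by (auto simp: mdeg_add)
qed

lemma pdeg_square:
  fixes p :: "'v::finite rpoly"
  shows "pdeg (p\<^sup>2) = 2 * pdeg p"
  by (cases "p = 0") (simp_all add: power2_eq_square pdeg_mult)

lemma pdeg_mult_square_le_iff:
  fixes p q :: "'v::finite rpoly"
  assumes "q \<noteq> 0" "p \<noteq> 0"
  shows "pdeg (q * p\<^sup>2) \<le> 2 * k \<longleftrightarrow> keys p \<noteq> {} \<and> keys p \<subseteq> loc_index k q"
proof -
  have "p\<^sup>2 \<noteq> 0" using pdeg_mult(1)[OF assms(2,2)] by (simp add: power2_eq_square)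
  then have "pdeg (q * p\<^sup>2) = pdeg q + 2 * pdeg p"
    using pdeg_mult(2)[OF assms(1)] by (simp add: pdeg_square)
  moreover obtain \<alpha> where "\<alpha> \<in> keys p" "mdeg \<alpha> = pdeg p"
    using top_expo_exists[OF assms(2)] by metis
  ultimately show ?thesis
    using assms(2) mdeg_le_pdeg[of _ p] by (fastforce simp: loc_index_def)
qed

lemma riesz_superset:
  assumes "finite S" "keys f \<subseteq> S"
  shows "riesz w f = (\<Sum>\<alpha>\<in>S. lookup f \<alpha> * w \<alpha>)"
  unfolding riesz_def using assms
  by (intro sum.mono_neutral_left) (auto simp: in_keys_iff)

lemma riesz_zero [simp]: "riesz w 0 = 0"
  by (simp add: riesz_def)

lemma riesz_add: "riesz w (f + g) = riesz w f + riesz w g"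
proof -
  have "finite (keys f \<union> keys g)" "keys (f + g) \<subseteq> keys f \<union> keys g"
    by (auto simp: keys_add)
  then show ?thesis
    by (simp add: riesz_superset[of "keys f \<union> keys g"] lookup_add sum.distrib distrib_right)
qed

lemma riesz_sum: "riesz w (\<Sum>i\<in>S. f i) = (\<Sum>i\<in>S. riesz w (f i))"
  by (induction S rule: infinite_finite_induct) (auto simp: riesz_add)

lemma riesz_scale: "riesz w (Poly_Mapping.single 0 a * f) = a * riesz w f"
proof -
  have "Poly_Mapping.single 0 a * f = (\<Sum>\<beta>\<in>keys f. Poly_Mapping.single \<beta> (a * lookup f \<beta>))"
    by (subst poly_sum_monomials[OF finite_keys subset_refl, of f])
      (simp add: sum_distrib_left mult_single)
  also have "riesz w \<dots> = (\<Sum>\<beta>\<in>keys f. a * (lookup f \<beta> * w \<beta>))"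
    unfolding riesz_sum by (intro sum.cong refl) (auto simp: riesz_def)
  finally show ?thesis by (simp add: riesz_def sum_distrib_left)
qed

definition loc_entries ::
  "nat \<Rightarrow> 'v::finite rpoly \<Rightarrow> ('v expo \<Rightarrow> real) \<Rightarrow> 'v expo \<times> 'v expo \<Rightarrow> real" where
  "loc_entries k q w = (\<lambda>(\<beta>, \<gamma>)\<in>loc_index k q \<times> loc_index k q.
     riesz w (q * Poly_Mapping.single (\<beta> + \<gamma>) 1))"

lemma riesz_mult_square:
  fixes p q :: "'v::finite rpoly"
  assumes "keys p \<subseteq> loc_index k q"
  shows "riesz w (q * p\<^sup>2) =
    (\<Sum>\<beta>\<in>loc_index k q. \<Sum>\<gamma>\<in>loc_index k q. lookup p \<beta> * loc_entries k q w (\<beta>, \<gamma>) * lookup p \<gamma>)"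
proof -
  let ?J = "loc_index k q"
  have "q * p\<^sup>2 = (\<Sum>\<beta>\<in>?J. \<Sum>\<gamma>\<in>?J.
      Poly_Mapping.single 0 (lookup p \<beta> * lookup p \<gamma>) * (q * Poly_Mapping.single (\<beta> + \<gamma>) 1))"
    unfolding power2_eq_square
      poly_mult_monomials[OF finite_loc_index assms finite_loc_index assms] sum_distrib_left
    by (intro sum.cong refl) (simp add: mult.left_commute mult_single)
  then have "riesz w (q * p\<^sup>2) = (\<Sum>\<beta>\<in>?J. \<Sum>\<gamma>\<in>?J.
      lookup p \<beta> * lookup p \<gamma> * riesz w (q * Poly_Mapping.single (\<beta> + \<gamma>) 1))"
    by (simp only: riesz_sum riesz_scale)
  also have "\<dots> = (\<Sum>\<beta>\<in>?J. \<Sum>\<gamma>\<in>?J. lookup p \<beta> * loc_entries k q w (\<beta>, \<gamma>) * lookup p \<gamma>)"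
    by (intro sum.cong refl) (simp add: loc_entries_def)
  finally show ?thesis .
qed

lemma is_loc_mat_entries: "is_loc_mat k q w (loc_entries k q w)"
  unfolding is_loc_mat_def
proof (intro conjI ballI allI impI)
  show "loc_entries k q w \<in> loc_index k q \<times> loc_index k q \<rightarrow>\<^sub>E UNIV"
    by (auto simp: loc_entries_def)
next
  fix \<beta> \<gamma> assume "\<beta> \<in> loc_index k q" "\<gamma> \<in> loc_index k q"
  then show "loc_entries k q w (\<beta>, \<gamma>) = loc_entries k q w (\<gamma>, \<beta>)"
    by (simp add: loc_entries_def add.commute)
next
  fix p :: "'a rpoly" assume deg: "pdeg (q * p\<^sup>2) \<le> 2 * k"
  show "riesz w (q * p\<^sup>2) = (\<Sum>\<beta>\<in>loc_index k q. \<Sum>\<gamma>\<in>loc_index k q.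
      lookup p \<beta> * loc_entries k q w (\<beta>, \<gamma>) * lookup p \<gamma>)"
  proof (cases "q = 0")
    case True
    then show ?thesis by (auto simp: loc_entries_def intro!: sum.neutral[symmetric])
  next
    case False
    then have "keys p \<subseteq> loc_index k q"
      using deg pdeg_mult_square_le_iff[of q p k] by (cases "p = 0") auto
    then show ?thesis by (rule riesz_mult_square)
  qed
qed

lemma loc_mat_unique:
  fixes q :: "'v::finite rpoly"
  assumes "is_loc_mat k q w M"
  shows "M = loc_entries k q w"
proof (rule PiE_ext[of M "loc_index k q \<times> loc_index k q" "\<lambda>_. UNIV"])
  let ?J = "loc_index k q"
  let ?N = "loc_entries k q w"
  show "M \<in> ?J \<times> ?J \<rightarrow>\<^sub>E UNIV" "?N \<in> ?J \<times> ?J \<rightarrow>\<^sub>E UNIV"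
    using assms is_loc_mat_entries[of k q w] by (auto simp: is_loc_mat_def)
  have deg: "pdeg (q * p\<^sup>2) \<le> 2 * k" if p: "keys p \<subseteq> ?J" for p :: "'v rpoly"
  proof (cases "p = 0 \<or> q = 0")
    case True
    then show ?thesis by auto
  next
    case False
    then show ?thesis using p by (simp add: pdeg_mult_square_le_iff)
  qed
  have form: "(\<Sum>\<beta>\<in>?J. \<Sum>\<gamma>\<in>?J. lookup p \<beta> * M (\<beta>, \<gamma>) * lookup p \<gamma>) =
      (\<Sum>\<beta>\<in>?J. \<Sum>\<gamma>\<in>?J. lookup p \<beta> * ?N (\<beta>, \<gamma>) * lookup p \<gamma>)"
    if p: "keys p \<subseteq> ?J" for p :: "'v rpoly"
    using assms deg[OF p] riesz_mult_square[OF p, of w] by (simp add: is_loc_mat_def)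
  have pair: "(\<Sum>\<beta>\<in>?J. \<Sum>\<gamma>\<in>?J. lookup p \<beta> * F (\<beta>, \<gamma>) * lookup p \<gamma>) =
      a * F (\<beta>0, \<beta>0) * a + a * F (\<beta>0, \<gamma>0) * b + b * F (\<gamma>0, \<beta>0) * a + b * F (\<gamma>0, \<gamma>0) * b"
    if "\<beta>0 \<in> ?J" "\<gamma>0 \<in> ?J" and p: "p = Poly_Mapping.single \<beta>0 a + Poly_Mapping.single \<gamma>0 b"
    for p :: "'v rpoly" and F :: "'v expo \<times> 'v expo \<Rightarrow> real" and \<beta>0 \<gamma>0 a b
  proof -
    have one: "(\<Sum>\<gamma>\<in>?J. G \<gamma> * lookup p \<gamma>) = G \<beta>0 * a + G \<gamma>0 * b" for G :: "'v expo \<Rightarrow> real"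
    proof -
      have "(\<Sum>\<gamma>\<in>?J. G \<gamma> * lookup p \<gamma>) =
          (\<Sum>\<gamma>\<in>?J. (if \<gamma> = \<beta>0 then G \<gamma> * a else 0) + (if \<gamma> = \<gamma>0 then G \<gamma> * b else 0))"
        by (intro sum.cong refl)
          (auto simp: p lookup_add lookup_single when_def distrib_left)
      then show ?thesis using that by (simp add: sum.distrib)
    qed
    have "(\<Sum>\<beta>\<in>?J. \<Sum>\<gamma>\<in>?J. lookup p \<beta> * F (\<beta>, \<gamma>) * lookup p \<gamma>) =
        (\<Sum>\<beta>\<in>?J. (F (\<beta>, \<beta>0) * a + F (\<beta>, \<gamma>0) * b) * lookup p \<beta>)"
      by (intro sum.cong refl) (subst one, simp add: algebra_simps)
    also have "\<dots> = (F (\<beta>0, \<beta>0) * a + F (\<beta>0, \<gamma>0) * b) * a + (F (\<gamma>0, \<beta>0) * a + F (\<gamma>0, \<gamma>0) * b) * b"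
      by (rule one)
    finally show ?thesis by (simp add: algebra_simps)
  qed
  have keys_pair: "keys (Poly_Mapping.single \<beta> a + Poly_Mapping.single \<gamma> b) \<subseteq> ?J"
    if "\<beta> \<in> ?J" "\<gamma> \<in> ?J" for \<beta> \<gamma> and a b :: real
    using that by (intro order_trans[OF keys_add]) auto
  have diag: "M (\<beta>, \<beta>) = ?N (\<beta>, \<beta>)" if "\<beta> \<in> ?J" for \<beta>
    using form[OF keys_pair[OF that that, of 1 0]]
    unfolding pair[OF that that refl] by simp
  fix z assume "z \<in> ?J \<times> ?J"
  then obtain \<beta> \<gamma> where z: "z = (\<beta>, \<gamma>)" and J: "\<beta> \<in> ?J" "\<gamma> \<in> ?J" by auto
  have "M (\<beta>, \<beta>) + M (\<beta>, \<gamma>) + M (\<gamma>, \<beta>) + M (\<gamma>, \<gamma>) =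
      ?N (\<beta>, \<beta>) + ?N (\<beta>, \<gamma>) + ?N (\<gamma>, \<beta>) + ?N (\<gamma>, \<gamma>)"
    using form[OF keys_pair[OF J, of 1 1]]
    unfolding pair[OF J refl] by simp
  moreover have "M (\<gamma>, \<beta>) = M (\<beta>, \<gamma>)" "?N (\<gamma>, \<beta>) = ?N (\<beta>, \<gamma>)"
    using assms is_loc_mat_entries[of k q w] J by (auto simp: is_loc_mat_def)
  ultimately show "M z = ?N z"
    using diag[OF J(1)] diag[OF J(2)] z by simp
qed

lemma loc_mat_eq: "loc_mat k q w = loc_entries k q w"
  unfolding loc_mat_def
  by (rule the_equality) (auto intro: is_loc_mat_entries loc_mat_unique)

end

theory Submission
  imports Defs
begin

text \<open>
  Homogenization turns \<open>K\<close> into the compact set \<open>S\<close> of all \<open>z = (z\<^sub>0, z')\<close> with \<open>|z| = 1\<close>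
  and \<open>z\<^sub>0 \<ge> 0\<close> that satisfy the homogenized constraints.
  Closedness at infinity says that the points of \<open>S\<close> are limits of multiples of points
  \<open>(1, x)\<close> with \<open>x \<in> K\<close>, so that a polynomial of degree at most \<open>d\<close> that is nonnegative on \<open>K\<close>
  has a degree \<open>d\<close> homogenization that is nonnegative on \<open>S\<close>, and an interior point \<open>q\<close> of the cone of
  such polynomials has one that is positive there (\<open>homogenize_at_interior_pos\<close>). Everything else
  rests on Putinar's Positivstellensatz on the sphere (\<open>positive_on_sphere_in_qmodule\<close>): a polynomial
  that is positive on \<open>S\<close> lies in the sum of the ideal and the quadratic module of the constraints.

  The Positivstellensatz is obtained algebraically. Modulo \<open>|z|\<^sup>2 - 1\<close> the sums of squares form an
  archimedean preordering \<open>T\<close>. If \<open>f\<close> is outside a \<open>T\<close>-module \<open>M\<close>, then \<open>M - T f\<close> does not contain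
  \<open>-1\<close> and extends to a maximal module with this property. Such a module is total, and the cut
  that it defines on the real line is a ring homomorphism to the reals, that is, the evaluation at a
  point, where \<open>M\<close> is nonnegative and \<open>f \<le> 0\<close> (\<open>nonmember_character\<close>).

  If \<open>p\<close> is interior in the cone of nonnegative polynomials with exponents in \<open>A\<close>, then
  \<open>p - \<epsilon> q\<close> is nonnegative on \<open>K\<close> for some \<open>\<epsilon> > 0\<close>. Hence the homogenization of \<open>p\<close> is positive on \<open>S\<close>, and
  \<open>p\<close> has a certificate of some finite degree. If \<open>y\<close> is outside the closure of the moment cone,
  a polynomial \<open>p \<ge> 0\<close> on \<open>K\<close> separates it, and the certificate for \<open>p + \<epsilon> q\<close> excludes \<open>y\<close> from
  the relaxations of high order. Conversely, a measure on \<open>K\<close> weighted with \<open>|(1, x)|\<^sup>d\<close> and moved to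
  the sphere yields a feasible vector for every order. The weight is at most a multiple of \<open>q\<close>, so
  these vectors are bounded locally in \<open>y\<close>, and by compactness each relaxation also contains the limits
  of moment vectors.
\<close>

section \<open>Modules over an archimedean preordering\<close>

text \<open>
  A commutative ring with a structure map \<open>\<kappa>\<close> from the reals, and in it a set \<open>T\<close> that contains
  all squares, is closed under sums and products, and is archimedean.
\<close>

locale archimedean_preordering =
  fixes \<kappa> :: "real \<Rightarrow> 'a::comm_ring_1" and T :: "'a set"
  assumes \<kappa>_add: "\<kappa> (r + s) = \<kappa> r + \<kappa> s"
    and \<kappa>_mult: "\<kappa> (r * s) = \<kappa> r * \<kappa> s"
    and \<kappa>_one: "\<kappa> 1 = 1"
    and T_square: "a * a \<in> T"
    and T_add: "a \<in> T \<Longrightarrow> b \<in> T \<Longrightarrow> a + b \<in> T"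
    and T_mult: "a \<in> T \<Longrightarrow> b \<in> T \<Longrightarrow> a * b \<in> T"
    and T_arch: "\<exists>N. \<kappa> N - a \<in> T"
begin

lemma \<kappa>_zero: "\<kappa> 0 = 0"
  using \<kappa>_add[of 0 0] by simp

lemma \<kappa>_minus: "\<kappa> (- r) = - \<kappa> r"
  using \<kappa>_add[of r "- r"] by (simp add: \<kappa>_zero minus_unique)

lemma \<kappa>_diff: "\<kappa> (r - s) = \<kappa> r - \<kappa> s"
  using \<kappa>_add[of r "- s"] by (simp add: \<kappa>_minus)

lemma \<kappa>_T: "0 \<le> r \<Longrightarrow> \<kappa> r \<in> T"
  using T_square[of "\<kappa> (sqrt r)"] by (simp flip: \<kappa>_mult)

lemma one_T: "1 \<in> T"
  using T_square[of 1] by simp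

lemma zero_T: "0 \<in> T"
  using T_square[of 0] by simp

text \<open>Modules over \<open>T\<close> that contain \<open>T\<close>. They may be improper, that is, contain \<open>-1\<close>.\<close>

definition T_module :: "'a set \<Rightarrow> bool" where
  "T_module Q \<longleftrightarrow> T \<subseteq> Q \<and> (\<forall>a\<in>Q. \<forall>b\<in>Q. a + b \<in> Q) \<and> (\<forall>t\<in>T. \<forall>a\<in>Q. t * a \<in> Q)"

lemma T_moduleD:
  assumes "T_module Q"
  shows "a \<in> T \<Longrightarrow> a \<in> Q" and "a \<in> Q \<Longrightarrow> b \<in> Q \<Longrightarrow> a + b \<in> Q"
    and "t \<in> T \<Longrightarrow> a \<in> Q \<Longrightarrow> t * a \<in> Q"
  using assms by (auto simp: T_module_def)

lemma T_module_adjoin: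
  assumes Q: "T_module Q"
  shows "T_module {q + t * a | q t. q \<in> Q \<and> t \<in> T}" (is "T_module ?R")
    and "Q \<subseteq> {q + t * a | q t. q \<in> Q \<and> t \<in> T}"
    and "a \<in> {q + t * a | q t. q \<in> Q \<and> t \<in> T}"
proof -
  have "q + 0 * a \<in> ?R" if "q \<in> Q" for q
    using that zero_T by blast
  then show sub: "Q \<subseteq> ?R" by auto
  have "0 + 1 * a \<in> ?R" using one_T T_moduleD(1)[OF Q zero_T] by blast
  then show "a \<in> ?R" by simp
  show "T_module ?R"
    unfolding T_module_def
  proof (intro conjI ballI)
    show "T \<subseteq> ?R" using sub T_moduleD(1)[OF Q] by blast
  next
    fix b c assume "b \<in> ?R" "c \<in> ?R"
    then obtain q t q' t' where "b = q + t * a" "c = q' + t' * a" "q \<in> Q" "q' \<in> Q" "t \<in> T" "t' \<in> T"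
      by blast
    moreover from this have "b + c = (q + q') + (t + t') * a" by (simp add: algebra_simps)
    ultimately show "b + c \<in> ?R" using T_moduleD(2)[OF Q] T_add by blast
  next
    fix s b assume s: "s \<in> T" and "b \<in> ?R"
    then obtain q t where "b = q + t * a" "q \<in> Q" "t \<in> T" by blast
    moreover from this have "s * b = s * q + (s * t) * a" by (simp add: algebra_simps)
    ultimately show "s * b \<in> ?R" using T_moduleD(3)[OF Q s] T_mult[OF s] by blast
  qed
qed

text \<open>
  A proper module that is maximal for inclusion is total, and the corresponding cut of the
  real line is a ring homomorphism.
\<close>

lemma maximal_T_module_total:
  assumes Q: "T_module Q" and proper: "-1 \<notin> Q"
    and max: "\<And>R. T_module R \<Longrightarrow> -1 \<notin> R \<Longrightarrow> Q \<subseteq> R \<Longrightarrow> R = Q"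
  shows "a \<in> Q \<or> - a \<in> Q"
proof (rule ccontr)
  assume contr: "\<not> (a \<in> Q \<or> - a \<in> Q)"
  have ex: "\<exists>q t. -1 = q + t * b \<and> q \<in> Q \<and> t \<in> T" if "b \<notin> Q" for b
    using max[OF T_module_adjoin(1)[OF Q, of b]] T_module_adjoin(2,3)[OF Q, of b] that by blast
  obtain q s where q: "-1 = q + s * a" "q \<in> Q" "s \<in> T" using ex[of a] contr by blast
  obtain q' s' where q': "-1 = q' + s' * (- a)" "q' \<in> Q" "s' \<in> T" using ex[of "- a"] contr by blast
  have "q = -1 - s * a" "q' = -1 - s' * (- a)"
    using q(1) q'(1) by (metis add_diff_cancel_right')+
  then have "s' * q + s * q' + s' = s' * (-1 - s * a) + s * (-1 - s' * (- a)) + s'"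
    by (simp only:)
  also have "\<dots> = - s" by (simp add: algebra_simps)
  finally have eq: "- s = s' * q + s * q' + s'" by (rule sym)
  have neg: "- s \<in> Q" unfolding eq
    by (intro T_moduleD(2)[OF Q] T_moduleD(3)[OF Q] T_moduleD(1)[OF Q] q q')
  \<comment> \<open>\<open>s\<close> lies in the support \<open>Q \<inter> - Q\<close>, which is an ideal since
    \<open>4 a = (a + 1)\<^sup>2 - (a - 1)\<^sup>2\<close>.\<close>
  have quarter: "\<kappa> (1/4) * 4 = 1"
    using \<kappa>_mult[of "1/4" 4] \<kappa>_add[of 2 2] \<kappa>_add[of 1 1] \<kappa>_one by simp
  have id: "x = (\<kappa> (1/4) * 4) * x" for x using quarter by simp
  have "s * a = \<kappa> (1/4) * ((a + 1) * (a + 1) * s + (a - 1) * (a - 1) * (- s))"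
    by (subst id) (simp add: algebra_simps)
  also have "\<dots> \<in> Q"
    by (intro T_moduleD(3)[OF Q \<kappa>_T] T_moduleD(2)[OF Q] T_moduleD(3)[OF Q T_square] neg
        T_moduleD(1)[OF Q] q) simp
  finally have "s * a \<in> Q" .
  then have "q + s * a \<in> Q" using T_moduleD(2)[OF Q] q by blast
  then show False using q(1) proper by simp
qed

lemma maximal_T_module_character:
  assumes Q: "T_module Q" and proper: "-1 \<notin> Q"
    and total: "\<And>a. a \<in> Q \<or> - a \<in> Q"
  obtains \<phi> :: "'a \<Rightarrow> real" where
    "\<And>a b. \<phi> (a + b) = \<phi> a + \<phi> b" "\<And>a b. \<phi> (a * b) = \<phi> a * \<phi> b" "\<And>r. \<phi> (\<kappa> r) = r"
    "\<And>a. a \<in> Q \<Longrightarrow> 0 \<le> \<phi> a"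
proof -
  note Q_T = T_moduleD(1)[OF Q] and Q_add = T_moduleD(2)[OF Q] and Q_mult = T_moduleD(3)[OF Q]
  have \<kappa>_neg: "\<kappa> r \<notin> Q" if "r < 0" for r
  proof
    assume "\<kappa> r \<in> Q"
    then have "\<kappa> (1 / - r) * \<kappa> r \<in> Q" using that by (intro Q_mult \<kappa>_T) auto
    moreover have "\<kappa> (1 / - r) * \<kappa> r = -1"
      using that \<kappa>_minus[of 1] by (simp add: \<kappa>_one flip: \<kappa>_mult)
    ultimately show False using proper by simp
  qed
  have eps_le: "x \<le> y" if "\<And>e. 0 < e \<Longrightarrow> x - e \<le> y" for x y :: real
    by (rule field_le_epsilon) (use that in \<open>simp only: diff_le_eq\<close>)
  define D where "D a = {r. a - \<kappa> r \<in> Q}" for a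
  define \<phi> where "\<phi> a = Sup (D a)" for a
  have D_nonempty: "D a \<noteq> {}" for a
  proof -
    obtain N where "\<kappa> N - (- a) \<in> T" using T_arch by blast
    then have "a - \<kappa> (- N) \<in> Q" using Q_T by (simp add: \<kappa>_minus add.commute)
    then show ?thesis unfolding D_def by blast
  qed
  have D_bdd: "bdd_above (D a)" for a
  proof -
    obtain N where N: "\<kappa> N - a \<in> T" using T_arch by blast
    have "r \<le> N" if "r \<in> D a" for r
    proof -
      have "(\<kappa> N - a) + (a - \<kappa> r) \<in> Q" using N that by (intro Q_add) (auto simp: D_def Q_T)
      then have "\<kappa> (N - r) \<in> Q" by (simp add: \<kappa>_diff)
      then show ?thesis using \<kappa>_neg[of "N - r"] by force
    qed
    then show ?thesis by (auto simp: bdd_above_def)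
  qed
  have below: "a - \<kappa> r \<in> Q" if less: "r < \<phi> a" for a r
  proof -
    obtain s where s: "s \<in> D a" "r < s"
      using less less_cSup_iff[OF D_nonempty D_bdd] unfolding \<phi>_def by blast
    have "(a - \<kappa> s) + \<kappa> (s - r) \<in> Q" using s by (intro Q_add Q_T[OF \<kappa>_T]) (auto simp: D_def)
    then show ?thesis by (simp add: \<kappa>_diff)
  qed
  have above: "\<kappa> r - a \<in> Q" if less: "\<phi> a < r" for a r
  proof -
    have "r \<notin> D a"
      using less cSup_upper[OF _ D_bdd, of r a] unfolding \<phi>_def by (meson not_le)
    then show ?thesis using total[of "a - \<kappa> r"] by (simp add: D_def)
  qed
  have ge: "r \<le> \<phi> a" if "a - \<kappa> r \<in> Q" for a r
    using that cSup_upper[OF _ D_bdd] by (simp add: \<phi>_def D_def)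
  have le: "\<phi> a \<le> r" if mem: "\<kappa> r - a \<in> Q" for a r
  proof (rule ccontr)
    assume "\<not> \<phi> a \<le> r"
    then obtain s where s: "r < s" "s < \<phi> a" using dense[of r "\<phi> a"] by (meson not_le)
    have "(\<kappa> r - a) + (a - \<kappa> s) \<in> Q" using mem below[OF s(2)] by (rule Q_add)
    then have "\<kappa> (r - s) \<in> Q" by (simp add: \<kappa>_diff)
    then show False using \<kappa>_neg[of "r - s"] s(1) by simp
  qed
  have \<phi>_\<kappa>: "\<phi> (\<kappa> r) = r" for r
    using le[of r "\<kappa> r"] ge[of "\<kappa> r" r] Q_T[OF zero_T] by simp
  have \<phi>_Q: "0 \<le> \<phi> a" if "a \<in> Q" for a
    using ge[of a 0] that by (simp add: \<kappa>_zero)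
  have \<phi>_add: "\<phi> (a + b) = \<phi> a + \<phi> b" for a b
  proof (rule antisym)
    have "\<phi> (a + b) \<le> \<phi> a + \<phi> b + e" if "0 < e" for e
    proof (rule le)
      have "(\<kappa> (\<phi> a + e/2) - a) + (\<kappa> (\<phi> b + e/2) - b) \<in> Q"
        using that by (intro Q_add above) auto
      also have "(\<kappa> (\<phi> a + e/2) - a) + (\<kappa> (\<phi> b + e/2) - b)
          = \<kappa> ((\<phi> a + e/2) + (\<phi> b + e/2)) - (a + b)"
        by (simp only: \<kappa>_add add_diff_add)
      also have "(\<phi> a + e/2) + (\<phi> b + e/2) = \<phi> a + \<phi> b + e" by simp
      finally show "\<kappa> (\<phi> a + \<phi> b + e) - (a + b) \<in> Q" .
    qed
    then show "\<phi> (a + b) \<le> \<phi> a + \<phi> b" by (rule field_le_epsilon)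
    have "\<phi> a + \<phi> b - e \<le> \<phi> (a + b)" if "0 < e" for e
    proof (rule ge)
      have "(a - \<kappa> (\<phi> a - e/2)) + (b - \<kappa> (\<phi> b - e/2)) \<in> Q"
        using that by (intro Q_add below) auto
      also have "(a - \<kappa> (\<phi> a - e/2)) + (b - \<kappa> (\<phi> b - e/2))
          = (a + b) - \<kappa> ((\<phi> a - e/2) + (\<phi> b - e/2))"
        by (simp only: \<kappa>_add add_diff_add)
      also have "(\<phi> a - e/2) + (\<phi> b - e/2) = \<phi> a + \<phi> b - e" by simp
      finally show "a + b - \<kappa> (\<phi> a + \<phi> b - e) \<in> Q" .
    qed
    then show "\<phi> a + \<phi> b \<le> \<phi> (a + b)" by (rule eps_le)
  qed
  have \<phi>_minus: "\<phi> (- a) = - \<phi> a" for a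
    using \<phi>_add[of a "- a"] \<phi>_\<kappa>[of 0] by (simp add: \<kappa>_zero)
  have \<phi>_scale: "\<phi> (\<kappa> r * a) = r * \<phi> a" if "0 \<le> r" for r a
  proof (rule antisym)
    have *: "r * \<phi> b \<le> \<phi> (\<kappa> r * b)" for b
    proof (cases "r = 0")
      case True
      then show ?thesis using \<phi>_\<kappa>[of 0] by (simp add: \<kappa>_zero)
    next
      case False
      then have r: "0 < r" using that by simp
      have "r * \<phi> b - e \<le> \<phi> (\<kappa> r * b)" if "0 < e" for e
      proof (rule ge)
        have "\<kappa> r * (b - \<kappa> (\<phi> b - e / r)) \<in> Q"
          using that r by (intro Q_mult \<kappa>_T below) auto
        moreover have "\<kappa> r * \<kappa> (\<phi> b - e / r) = \<kappa> (r * \<phi> b - e)"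
          using r by (simp flip: \<kappa>_mult add: right_diff_distrib)
        ultimately show "\<kappa> r * b - \<kappa> (r * \<phi> b - e) \<in> Q"
          by (simp add: right_diff_distrib)
      qed
      then show ?thesis by (rule eps_le)
    qed
    show "r * \<phi> a \<le> \<phi> (\<kappa> r * a)" by (rule *)
    show "\<phi> (\<kappa> r * a) \<le> r * \<phi> a" using *[of "- a"] by (simp add: \<phi>_minus)
  qed
  \<comment> \<open>Multiplication by an element of \<open>T\<close> preserves \<open>Q\<close>, hence the kernel of \<open>\<phi>\<close>.\<close>
  have kernel: "\<phi> (t * a) = 0" if t: "t \<in> T" and a: "\<phi> a = 0" for t a
  proof -
    have bound: "- (e * \<phi> t) \<le> \<phi> (t * b)" if "0 < e" "\<phi> b = 0" for e b
    proof -
      have "t * (b - \<kappa> (- e)) \<in> Q" using t that by (intro Q_mult below) auto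
      then have "0 \<le> \<phi> (t * (b - \<kappa> (- e)))" by (rule \<phi>_Q)
      also have "t * (b - \<kappa> (- e)) = t * b + \<kappa> e * t" by (simp add: \<kappa>_minus algebra_simps)
      finally show ?thesis using \<open>0 < e\<close> by (simp add: \<phi>_add \<phi>_scale)
    qed
    have nonneg: "0 \<le> \<phi> (t * b)" if b: "\<phi> b = 0" for b
    proof (rule field_le_epsilon)
      fix e :: real assume e: "0 < e"
      have t0: "0 \<le> \<phi> t" using t by (intro \<phi>_Q Q_T)
      have "e / (\<phi> t + 1) * \<phi> t \<le> e" using e t0 by (simp add: field_simps)
      then show "0 \<le> \<phi> (t * b) + e"
        using bound[of "e / (\<phi> t + 1)" b] e t0 b by simp
    qed
    show ?thesis using nonneg[of a] nonneg[of "- a"] a by (simp add: \<phi>_minus)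
  qed
  have mult_T: "\<phi> (t * a) = \<phi> t * \<phi> a" if t: "t \<in> T" for t a
  proof -
    have scale: "\<phi> (\<kappa> r * b) = r * \<phi> b" for r b
    proof (cases "0 \<le> r")
      case True
      then show ?thesis by (rule \<phi>_scale)
    next
      case False
      then have "\<phi> (\<kappa> (- r) * b) = - r * \<phi> b" by (intro \<phi>_scale) simp
      then show ?thesis by (simp add: \<kappa>_minus \<phi>_minus)
    qed
    have "\<phi> (a + \<kappa> (- \<phi> a)) = 0" by (simp only: \<phi>_add \<phi>_\<kappa> add.right_inverse)
    then have "\<phi> (t * (a + \<kappa> (- \<phi> a))) = 0" by (rule kernel[OF t])
    also have "t * (a + \<kappa> (- \<phi> a)) = t * a + \<kappa> (- \<phi> a) * t" by (simp add: algebra_simps)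
    also have "\<phi> \<dots> = \<phi> (t * a) + - \<phi> a * \<phi> t" by (simp only: \<phi>_add scale)
    finally show ?thesis by simp
  qed
  have \<phi>_mult: "\<phi> (b * a) = \<phi> b * \<phi> a" for a b
  proof -
    have id: "(b + 1) * (b + 1) = b * b + b + b + 1 * 1" by (simp add: algebra_simps)
    have "\<phi> ((b + 1) * (b + 1) * a) = \<phi> ((b + 1) * (b + 1)) * \<phi> a"
      by (rule mult_T[OF T_square])
    moreover have "(b + 1) * (b + 1) * a = b * b * a + b * a + b * a + 1 * 1 * a"
      by (simp add: algebra_simps)
    ultimately have "\<phi> (b * b * a) + \<phi> (b * a) + \<phi> (b * a) + \<phi> (1 * 1 * a)
        = (\<phi> (b * b) + \<phi> b + \<phi> b + \<phi> (1 * 1)) * \<phi> a"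
      by (simp only: id \<phi>_add)
    then show ?thesis using mult_T[OF T_square, of b a] \<phi>_\<kappa>[of 1]
      by (simp add: \<kappa>_one algebra_simps)
  qed
  show ?thesis by (rule that[OF \<phi>_add \<phi>_mult \<phi>_\<kappa> \<phi>_Q])
qed

text \<open>
  Every proper \<open>T\<close>-module is nonnegative under some character. This is the step in which Zorn's
  lemma enters.
\<close>

lemma proper_T_module_character:
  assumes M: "T_module M" and proper: "-1 \<notin> M"
  obtains \<phi> :: "'a \<Rightarrow> real" where
    "\<And>a b. \<phi> (a + b) = \<phi> a + \<phi> b" "\<And>a b. \<phi> (a * b) = \<phi> a * \<phi> b" "\<And>r. \<phi> (\<kappa> r) = r"
    "\<And>a. a \<in> M \<Longrightarrow> 0 \<le> \<phi> a"
proof -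
  define \<A> where "\<A> = {Q. T_module Q \<and> -1 \<notin> Q \<and> M \<subseteq> Q}"
  have "\<exists>Q\<in>\<A>. \<forall>X\<in>\<A>. Q \<subseteq> X \<longrightarrow> X = Q"
  proof (rule subset_Zorn_nonempty)
    show "\<A> \<noteq> {}" using M proper by (auto simp: \<A>_def)
  next
    fix \<C> assume ne: "\<C> \<noteq> {}" and chain: "subset.chain \<A> \<C>"
    have mods: "T_module Q" "-1 \<notin> Q" "M \<subseteq> Q" if "Q \<in> \<C>" for Q
      using chain that by (auto simp: subset.chain_def \<A>_def)
    have "T_module (\<Union>\<C>)"
      unfolding T_module_def
    proof (intro conjI ballI)
      show "T \<subseteq> \<Union>\<C>" using ne mods(1) T_moduleD(1) by blast
    next
      fix a b assume "a \<in> \<Union>\<C>" "b \<in> \<Union>\<C>"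
      then obtain P Q where PQ: "P \<in> \<C>" "Q \<in> \<C>" "a \<in> P" "b \<in> Q" by blast
      then have "P \<subseteq> Q \<or> Q \<subseteq> P" using chain by (auto simp: subset_chain_def)
      then show "a + b \<in> \<Union>\<C>" using PQ mods(1) T_moduleD(2) by blast
    next
      fix t a assume "t \<in> T" "a \<in> \<Union>\<C>"
      then show "t * a \<in> \<Union>\<C>" using mods(1) T_moduleD(3) by blast
    qed
    then show "\<Union>\<C> \<in> \<A>" using ne mods(2,3) by (auto simp: \<A>_def)
  qed
  then obtain Q where Q: "T_module Q" "-1 \<notin> Q" "M \<subseteq> Q"
    and max: "\<And>X. X \<in> \<A> \<Longrightarrow> Q \<subseteq> X \<Longrightarrow> X = Q"
    by (auto simp: \<A>_def)
  have "a \<in> Q \<or> - a \<in> Q" for a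
    using Q(3) by (intro maximal_T_module_total[OF Q(1,2)] max) (auto simp: \<A>_def)
  then show ?thesis
    using maximal_T_module_character[OF Q(1,2)] that Q(3) by (metis subsetD)
qed

text \<open>
  If \<open>f \<notin> M\<close>, then even \<open>M - T f\<close> is proper: from \<open>f t - 1 \<in> M\<close> and \<open>N - t \<in> T\<close> the constant \<open>r\<close> in
  \<open>f + r \<in> M\<close> can be lowered by \<open>1/N\<close>, repeatedly, until it vanishes.
\<close>

theorem nonmember_character:
  assumes M: "T_module M" and f: "f \<notin> M"
  obtains \<phi> :: "'a \<Rightarrow> real" where
    "\<And>a b. \<phi> (a + b) = \<phi> a + \<phi> b" "\<And>a b. \<phi> (a * b) = \<phi> a * \<phi> b" "\<And>r. \<phi> (\<kappa> r) = r"
    "\<And>a. a \<in> M \<Longrightarrow> 0 \<le> \<phi> a" "\<phi> f \<le> 0"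
proof -
  let ?R = "{q + t * (- f) | q t. q \<in> M \<and> t \<in> T}"
  note M_T = T_moduleD(1)[OF M] and M_add = T_moduleD(2)[OF M] and M_mult = T_moduleD(3)[OF M]
  have proper: "-1 \<notin> ?R"
  proof
    assume "-1 \<in> ?R"
    then obtain m t where mt: "-1 = m + t * (- f)" "m \<in> M" "t \<in> T" by blast
    then have m: "m = t * f - 1" by (simp add: algebra_simps)
    obtain N0 where N0: "\<kappa> N0 - t \<in> T" using T_arch by blast
    define N where "N = max N0 1"
    have N: "\<kappa> N - t \<in> T" "0 < N"
      using T_add[OF N0 \<kappa>_T[of "N - N0"]] by (auto simp: N_def \<kappa>_diff)
    have step: "f + \<kappa> (r - 1/N) \<in> M" if "f + \<kappa> r \<in> M" "0 \<le> r" for r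
    proof -
      have "\<kappa> (1/N) * \<kappa> N = 1" using N(2) \<kappa>_one by (simp flip: \<kappa>_mult)
      then have inv: "\<kappa> (1/N) * (\<kappa> N * x) = x" for x by (simp flip: mult.assoc)
      have "t * \<kappa> r \<in> M" by (rule M_mult[OF mt(3) M_T[OF \<kappa>_T[OF that(2)]]])
      then have "(\<kappa> N - t) * (f + \<kappa> r) + m + t * \<kappa> r \<in> M"
        by (rule M_add[OF M_add[OF M_mult[OF N(1) that(1)] mt(2)]])
      moreover have "\<kappa> (1/N) \<in> T" using N(2) by (intro \<kappa>_T) simp
      ultimately have "\<kappa> (1/N) * ((\<kappa> N - t) * (f + \<kappa> r) + m + t * \<kappa> r) \<in> M"
        by (intro M_mult)
      also have "(\<kappa> N - t) * (f + \<kappa> r) + m + t * \<kappa> r = \<kappa> N * (f + \<kappa> r) - 1"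
        by (simp add: m algebra_simps)
      also have "\<kappa> (1/N) * \<dots> = f + \<kappa> r - \<kappa> (1/N)"
        by (simp add: right_diff_distrib inv)
      finally show ?thesis by (simp add: \<kappa>_diff add_diff_eq)
    qed
    obtain r0 where r0: "\<kappa> r0 - (- f) \<in> T" using T_arch by blast
    have iter: "\<exists>s \<le> max 0 (r0 - real j / N). f + \<kappa> s \<in> M" for j
    proof (induction j)
      case 0
      then show ?case using M_T[OF r0] by (intro exI[of _ r0]) (simp add: add.commute)
    next
      case (Suc j)
      then obtain s where s: "s \<le> max 0 (r0 - real j / N)" "f + \<kappa> s \<in> M" by blast
      show ?case
      proof (cases "0 \<le> s")
        case True
        have "s - 1/N \<le> max 0 (r0 - real (Suc j) / N)"
        proof -
          have "real (Suc j) / N = real j / N + 1/N" "0 < 1/N"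
            using N(2) by (simp_all add: add_divide_distrib)
          then show ?thesis using s(1) by linarith
        qed
        then show ?thesis using step[OF s(2) True] by blast
      next
        case False
        then show ?thesis using s(2) by (intro exI[of _ s]) auto
      qed
    qed
    obtain j :: nat where "r0 * N \<le> real j" using real_arch_simple by blast
    then have "r0 - real j / N \<le> 0" using N(2) by (simp add: field_simps)
    then obtain s where s: "s \<le> 0" "f + \<kappa> s \<in> M" using iter[of j] by auto
    have "f + \<kappa> s + \<kappa> (- s) \<in> M" using s(1) by (intro M_add[OF s(2)] M_T[OF \<kappa>_T]) auto
    then show False using f by (simp add: \<kappa>_minus)
  qed
  obtain \<phi> :: "'a \<Rightarrow> real" where \<phi>: "\<And>a b. \<phi> (a + b) = \<phi> a + \<phi> b"
    "\<And>a b. \<phi> (a * b) = \<phi> a * \<phi> b" "\<And>r. \<phi> (\<kappa> r) = r" "\<And>a. a \<in> ?R \<Longrightarrow> 0 \<le> \<phi> a"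
    using proper_T_module_character[OF T_module_adjoin(1)[OF M] proper] by blast
  have "0 \<le> \<phi> (- f)" using \<phi>(4) T_module_adjoin(3)[OF M] by blast
  moreover have "\<phi> f + \<phi> (- f) = 0" using \<phi>(1)[of f "- f"] \<phi>(3)[of 0] by (simp add: \<kappa>_zero)
  ultimately have "\<phi> f \<le> 0" by linarith
  then show ?thesis using that[OF \<phi>(1-3)] \<phi>(4) T_module_adjoin(2)[OF M] by blast
qed

end


section \<open>Polynomial functions\<close>

text \<open>Constant polynomials.\<close>

definition cst :: "real \<Rightarrow> 'v::finite rpoly" where
  "cst r = Poly_Mapping.single 0 r"

lemma cst_zero [simp]: "cst 0 = 0"
  by (simp add: cst_def)

lemma cst_one [simp]: "cst 1 = 1"
  by (simp add: cst_def)

lemma cst_add: "cst (r + s) = cst r + cst s"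
  by (simp add: cst_def single_add)

lemma cst_mult: "cst (r * s) = cst r * cst s"
  by (simp add: cst_def mult_single)

lemma cst_half: "cst (1/2) * (p + p) = p"
proof -
  have "cst (1/2) * (p + p) = (cst (1/2) + cst (1/2)) * p" by (simp only: distrib_left distrib_right)
  also have "\<dots> = p" by (simp flip: cst_add)
  finally show ?thesis .
qed

lemma monom_eval_zero [simp]: "monom_eval 0 x = 1"
  by (simp add: monom_eval_def)

lemma monom_eval_add: "monom_eval (\<alpha> + \<beta>) x = monom_eval \<alpha> x * monom_eval \<beta> x"
  by (simp add: monom_eval_def lookup_add power_add prod.distrib)

lemma monom_eval_single: "monom_eval (Poly_Mapping.single i m) x = (x $ i) ^ m"
proof -
  have "monom_eval (Poly_Mapping.single i m) x = (\<Prod>j\<in>UNIV. if j = i then (x $ j) ^ m else 1)"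
    unfolding monom_eval_def by (intro prod.cong) (auto simp: lookup_single when_def)
  then show ?thesis by simp
qed

lemma peval_single: "peval (Poly_Mapping.single \<alpha> r) x = r * monom_eval \<alpha> x"
  by (subst peval_superset[of "{\<alpha>}"]) auto

lemma peval_zero [simp]: "peval 0 x = 0"
  by (simp add: peval_def)

lemma peval_add: "peval (p + q) x = peval p x + peval q x"
proof -
  have "finite (keys p \<union> keys q)" "keys (p + q) \<subseteq> keys p \<union> keys q"
    by (auto simp: keys_add)
  then show ?thesis
    by (simp add: peval_superset[of "keys p \<union> keys q"] lookup_add sum.distrib distrib_right)
qed

lemma peval_sum: "peval (\<Sum>i\<in>S. f i) x = (\<Sum>i\<in>S. peval (f i) x)"
  by (induction S rule: infinite_finite_induct) (auto simp: peval_add)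

lemma peval_mult: "peval (p * q) x = peval p x * peval q x"
  unfolding poly_mult_monomials[OF finite_keys subset_refl finite_keys subset_refl, of p q]
  by (simp add: peval_sum peval_single monom_eval_add sum_product)
    (simp add: peval_def sum_product algebra_simps)

lemma peval_cst [simp]: "peval (cst r) x = r"
  by (simp add: cst_def peval_single)

lemma peval_one [simp]: "peval 1 x = 1"
  using peval_cst[of 1] by simp

lemma peval_pvar [simp]: "peval (pvar i) x = x $ i"
  by (simp add: pvar_def peval_single monom_eval_single)

lemma peval_minus: "peval (- p) x = - peval p x"
  using peval_add[of p "- p" x] by simp

lemma peval_diff: "peval (p - q) x = peval p x - peval q x"
  using peval_add[of p "- q" x] by (simp add: peval_minus)

lemma peval_power: "peval (p ^ m) x = peval p x ^ m"
  by (induction m) (auto simp: peval_mult)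

lemma continuous_on_monom_eval: "continuous_on S (monom_eval \<alpha>)"
proof -
  have "continuous_on S (\<lambda>x. monom_eval \<alpha> x)"
    unfolding monom_eval_def by (intro continuous_intros)
  then show ?thesis by simp
qed

lemma continuous_on_peval: "continuous_on S (peval p)"
proof -
  have "continuous_on S (\<lambda>x. peval p x)"
    unfolding peval_def by (intro continuous_intros continuous_on_monom_eval)
  then show ?thesis by simp
qed

lemma peval_sphere_poly: "peval sphere_poly x = (norm x)\<^sup>2 - 1"
  by (simp add: sphere_poly_def peval_diff peval_sum peval_power norm_vec_def L2_set_def
      sum_nonneg)

lemma rpoly_induct [case_names cst pvar add mult]:
  fixes p :: "'v::finite rpoly"
  assumes cst: "\<And>r. P (cst r)" and pvar: "\<And>i. P (pvar i)"
    and add: "\<And>p q. P p \<Longrightarrow> P q \<Longrightarrow> P (p + q)" and mult: "\<And>p q. P p \<Longrightarrow> P q \<Longrightarrow> P (p * q)"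
  shows "P p"
proof -
  have prod: "P (\<Prod>i\<in>S. f i)" if "\<And>i. P (f i)" for f :: "'v \<Rightarrow> 'v rpoly" and S
    using cst[of 1] by (induction S rule: infinite_finite_induct) (auto intro: mult that)
  have sum: "P (\<Sum>i\<in>S. f i)" if "\<And>i. P (f i)" for f :: "'v expo \<Rightarrow> 'v rpoly" and S
    using cst[of 0] by (induction S rule: infinite_finite_induct) (auto intro: add that)
  have power: "P (q ^ m)" if "P q" for q m
    using cst[of 1] by (induction m) (auto intro: mult that)
  have pvar_power: "pvar i ^ m = Poly_Mapping.single (Poly_Mapping.single i m) 1"
    for i :: 'v and m
    by (induction m) (simp_all add: pvar_def mult_single flip: single_add)
  have prod_single: "(\<Prod>i\<in>S. Poly_Mapping.single (f i) 1) = Poly_Mapping.single (\<Sum>i\<in>S. f i) 1"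
    for f :: "'v \<Rightarrow> 'v expo" and S :: "'v set"
    by (induction S rule: infinite_finite_induct) (auto simp: mult_single)
  have expo: "(\<Sum>i\<in>UNIV. Poly_Mapping.single i (lookup \<alpha> i)) = \<alpha>" for \<alpha> :: "'v expo"
  proof (rule poly_mapping_eqI)
    fix j
    have "lookup (\<Sum>i\<in>UNIV. Poly_Mapping.single i (lookup \<alpha> i)) j
        = (\<Sum>i\<in>UNIV. if i = j then lookup \<alpha> i else 0)"
      unfolding lookup_sum by (intro sum.cong) (auto simp: lookup_single when_def)
    then show "lookup (\<Sum>i\<in>UNIV. Poly_Mapping.single i (lookup \<alpha> i)) j = lookup \<alpha> j" by simp
  qed
  have "Poly_Mapping.single \<alpha> r = cst r * (\<Prod>i\<in>UNIV. pvar i ^ lookup \<alpha> i)" for \<alpha> :: "'v expo" and r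
    by (simp add: pvar_power prod_single expo cst_def mult_single)
  then have "P (Poly_Mapping.single \<alpha> r)" for \<alpha> r
    using mult[OF cst prod[of "\<lambda>i. pvar i ^ lookup \<alpha> i", OF power[OF pvar]]] by simp
  then show ?thesis
    by (subst poly_sum_monomials[OF finite_keys subset_refl]) (rule sum)
qed

text \<open>A ring homomorphism to the reals that fixes the constants is the evaluation at a point.\<close>

lemma character_is_evaluation:
  fixes \<phi> :: "'v::finite rpoly \<Rightarrow> real"
  assumes "\<And>p q. \<phi> (p + q) = \<phi> p + \<phi> q" "\<And>p q. \<phi> (p * q) = \<phi> p * \<phi> q" "\<And>r. \<phi> (cst r) = r"
  shows "\<phi> p = peval p (\<chi> i. \<phi> (pvar i))"
  by (induction p rule: rpoly_induct) (simp_all add: assms peval_add peval_mult)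


section \<open>Positive polynomials on compact sets in the sphere\<close>

text \<open>Sums of squares, of any degree.\<close>

definition sos :: "'v::finite rpoly set" where
  "sos = {\<sigma>. \<exists>qs. \<sigma> = (\<Sum>q\<leftarrow>qs. q\<^sup>2)}"

text \<open>The sum of the ideal generated by \<open>H\<close> and the quadratic module generated by \<open>G\<close>.\<close>

inductive_set qmodule :: "'v::finite rpoly set \<Rightarrow> 'v rpoly set \<Rightarrow> 'v rpoly set"
  for H G :: "'v rpoly set" where
  qmodule_sos: "s \<in> sos \<Longrightarrow> s \<in> qmodule H G"
| qmodule_gen: "g \<in> G \<Longrightarrow> s \<in> sos \<Longrightarrow> g * s \<in> qmodule H G"
| qmodule_ideal: "h \<in> H \<Longrightarrow> h * u \<in> qmodule H G"
| qmodule_add: "a \<in> qmodule H G \<Longrightarrow> b \<in> qmodule H G \<Longrightarrow> a + b \<in> qmodule H G"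

lemma sos_square: "p\<^sup>2 \<in> sos"
  unfolding sos_def by (intro CollectI exI[of _ "[p]"]) simp

lemma sos_zero: "0 \<in> sos"
  unfolding sos_def by (intro CollectI exI[of _ "[]"]) simp

lemma sos_add: "a \<in> sos \<Longrightarrow> b \<in> sos \<Longrightarrow> a + b \<in> sos"
proof -
  assume "a \<in> sos" "b \<in> sos"
  then obtain ps qs where "a = (\<Sum>q\<leftarrow>ps. q\<^sup>2)" "b = (\<Sum>q\<leftarrow>qs. q\<^sup>2)" by (auto simp: sos_def)
  then show "a + b \<in> sos" unfolding sos_def by (intro CollectI exI[of _ "ps @ qs"]) simp
qed

lemma sos_sum: "(\<And>i. i \<in> S \<Longrightarrow> f i \<in> sos) \<Longrightarrow> (\<Sum>i\<in>S. f i) \<in> sos"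
  by (induction S rule: infinite_finite_induct) (auto intro: sos_add sos_zero)

lemma sos_sum_list: "(\<And>q. q \<in> set qs \<Longrightarrow> f q \<in> sos) \<Longrightarrow> (\<Sum>q\<leftarrow>qs. f q) \<in> sos"
  by (induction qs) (auto intro: sos_add sos_zero)

lemma sos_mult:
  assumes "a \<in> sos" "b \<in> sos"
  shows "a * b \<in> sos"
proof -
  obtain ps qs where "a = (\<Sum>p\<leftarrow>ps. p\<^sup>2)" "b = (\<Sum>q\<leftarrow>qs. q\<^sup>2)"
    using assms by (auto simp: sos_def)
  then have "a * b = (\<Sum>p\<leftarrow>ps. \<Sum>q\<leftarrow>qs. (p * q)\<^sup>2)"
    by (simp add: power_mult_distrib sum_list_const_mult sum_list_mult_const)
  then show ?thesis by (simp add: sos_sum_list sos_square)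
qed

lemma sos_cst: "0 \<le> r \<Longrightarrow> cst r \<in> sos"
  using sos_square[of "cst (sqrt r)"] by (simp add: power2_eq_square flip: cst_mult)

lemma peval_sos_nonneg: "s \<in> sos \<Longrightarrow> 0 \<le> peval s x"
proof -
  have "0 \<le> peval (\<Sum>q\<leftarrow>qs. q\<^sup>2) x" for qs :: "'a rpoly list"
    by (induction qs) (auto simp: peval_add peval_power)
  then show "s \<in> sos \<Longrightarrow> 0 \<le> peval s x" by (auto simp: sos_def)
qed

lemma qmodule_sos_mult:
  assumes "s \<in> sos" "a \<in> qmodule H G"
  shows "s * a \<in> qmodule H G"
  using assms(2)
proof induction
  case (qmodule_sos t)
  then show ?case by (intro qmodule.qmodule_sos sos_mult assms(1))
next
  case (qmodule_gen g t)
  then have "g * (s * t) \<in> qmodule H G" by (intro qmodule.qmodule_gen sos_mult assms(1))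
  then show ?case by (simp add: mult.left_commute)
next
  case (qmodule_ideal h u)
  then have "h * (s * u) \<in> qmodule H G" by (intro qmodule.qmodule_ideal)
  then show ?case by (simp add: mult.left_commute)
qed (simp add: distrib_left qmodule.qmodule_add)

lemma qmodule_mono: "a \<in> qmodule H G \<Longrightarrow> H \<subseteq> H' \<Longrightarrow> G \<subseteq> G' \<Longrightarrow> a \<in> qmodule H' G'"
  by (induction rule: qmodule.induct) (auto intro: qmodule.intros)

lemma qmodule_ideal_mult:
  assumes "t \<in> qmodule H {}" "H \<subseteq> H'" "a \<in> qmodule H' G"
  shows "t * a \<in> qmodule H' G"
  using assms(1)
proof induction
  case (qmodule_ideal h u)
  then have "h * (u * a) \<in> qmodule H' G" using assms(2) by (intro qmodule.qmodule_ideal) auto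
  then show ?case by (simp add: mult.assoc)
qed (auto simp: distrib_right intro: qmodule_sos_mult qmodule.qmodule_add assms(3))

text \<open>
  Modulo the equation of the sphere, \<open>2 (1 \<plusminus> x\<^sub>i)\<close> is the sum of squares
  \<open>(1 \<plusminus> x\<^sub>i)\<^sup>2 + (\<Sum>j\<noteq>i. x\<^sub>j\<^sup>2)\<close>, which bounds the variables. The bounded polynomials form a
  subring.
\<close>

lemma sphere_bounded:
  fixes a :: "'v::finite rpoly"
  defines "T \<equiv> qmodule {sphere_poly} {}"
  shows "\<exists>N. cst N - a \<in> T \<and> cst N + a \<in> T"
proof (induction a rule: rpoly_induct)
  case (cst r)
  have "cst \<bar>r\<bar> - cst r = (cst (\<bar>r\<bar> - r) :: 'v rpoly)"
    using cst_add[of "\<bar>r\<bar> - r" r] by (metis add_diff_cancel_right' diff_add_cancel)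
  moreover have "cst (\<bar>r\<bar> - r) \<in> T" "cst (\<bar>r\<bar> + r) \<in> T"
    unfolding T_def by (auto intro!: qmodule.qmodule_sos sos_cst)
  ultimately show ?case by (intro exI[of _ "\<bar>r\<bar>"]) (simp add: cst_add)
next
  case (pvar i)
  have "1 + e * pvar i \<in> T" if e: "e * e = 1" for e :: "'v rpoly"
  proof -
    let ?s = "(1 + e * pvar i)\<^sup>2 + (\<Sum>j\<in>UNIV - {i}. (pvar j)\<^sup>2)"
    have "(\<Sum>j\<in>UNIV. (pvar j)\<^sup>2) = (pvar i)\<^sup>2 + (\<Sum>j\<in>UNIV - {i}. (pvar j :: 'v rpoly)\<^sup>2)"
      by (intro sum.remove) auto
    then have "?s + sphere_poly * (-1)
        = (1 + e * pvar i) + (1 + e * pvar i) + (e * e - 1) * (pvar i)\<^sup>2"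
      unfolding sphere_poly_def by (simp add: power2_eq_square algebra_simps)
    then have "cst (1/2) * (?s + sphere_poly * (-1)) = 1 + e * pvar i"
      by (simp only: e diff_self mult_zero_left add_0_right cst_half)
    moreover have "?s + sphere_poly * (-1) \<in> T"
      unfolding T_def
      by (intro qmodule.qmodule_add qmodule.qmodule_sos sos_add sos_square sos_sum qmodule.qmodule_ideal) auto
    ultimately show ?thesis using qmodule_sos_mult[OF sos_cst[of "1/2"]] unfolding T_def
      by (metis half_gt_zero_iff less_eq_real_def zero_less_one)
  qed
  from this[of 1] this[of "-1"] show ?case by (intro exI[of _ 1]) simp
next
  case (add p q)
  then obtain N L where "cst N - p \<in> T" "cst N + p \<in> T" "cst L - q \<in> T" "cst L + q \<in> T" by blast
  then have "(cst N - p) + (cst L - q) \<in> T" "(cst N + p) + (cst L + q) \<in> T"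
    unfolding T_def by (auto intro: qmodule.qmodule_add)
  then show ?case by (intro exI[of _ "N + L"]) (simp add: cst_add algebra_simps)
next
  case (mult p q)
  then obtain N L where NL: "cst N - p \<in> T" "cst N + p \<in> T" "cst L - q \<in> T" "cst L + q \<in> T" by blast
  have T_mult: "a * b \<in> T" if "a \<in> T" "b \<in> T" for a b
    using that qmodule_ideal_mult[of a _ _ b] unfolding T_def by blast
  have T_add: "a + b \<in> T" if "a \<in> T" "b \<in> T" for a b
    using that unfolding T_def by (rule qmodule.qmodule_add)
  have half: "cst (1/2) \<in> T" unfolding T_def by (intro qmodule.qmodule_sos sos_cst) simp
  have "(cst N - p) * (cst L + q) + (cst N + p) * (cst L - q)
      = (cst N * cst L - p * q) + (cst N * cst L - p * q)"
    "(cst N - p) * (cst L - q) + (cst N + p) * (cst L + q)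
      = (cst N * cst L + p * q) + (cst N * cst L + p * q)"
    by (simp_all add: algebra_simps)
  then have eq: "cst (N * L) - p * q
      = cst (1/2) * ((cst N - p) * (cst L + q) + (cst N + p) * (cst L - q))"
    "cst (N * L) + p * q
      = cst (1/2) * ((cst N - p) * (cst L - q) + (cst N + p) * (cst L + q))"
    by (simp_all only: cst_half cst_mult)
  have "cst (N * L) - p * q \<in> T" "cst (N * L) + p * q \<in> T"
    unfolding eq by (intro T_mult T_add half NL)+
  then show ?case by blast
qed

interpretation sphere: archimedean_preordering cst "qmodule {sphere_poly} {} :: 'v::finite rpoly set"
proof
  fix a b :: "'v rpoly"
  show "a * a \<in> qmodule {sphere_poly} {}"
    using sos_square[of a] by (intro qmodule.qmodule_sos) (simp add: power2_eq_square)
  show "a * b \<in> qmodule {sphere_poly} {}"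
    if "a \<in> qmodule {sphere_poly} {}" "b \<in> qmodule {sphere_poly} {}"
    using that by (rule qmodule_ideal_mult[OF _ subset_refl])
  show "\<exists>N. cst N - a \<in> qmodule {sphere_poly} {}" using sphere_bounded[of a] by blast
qed (auto simp: cst_add cst_mult intro: qmodule.qmodule_add)

text \<open>
  Putinar's Positivstellensatz for closed subsets of the unit sphere. The generators in \<open>H\<close> and \<open>G\<close> may
  be infinite in number, and the set that they describe may be empty.
\<close>

theorem positive_on_sphere_in_qmodule:
  fixes f :: "'v::finite rpoly"
  assumes sphere: "sphere_poly \<in> H"
    and pos: "\<And>x. (\<And>h. h \<in> H \<Longrightarrow> peval h x = 0) \<Longrightarrow> (\<And>g. g \<in> G \<Longrightarrow> 0 \<le> peval g x) \<Longrightarrow> 0 < peval f x"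
  shows "f \<in> qmodule H G"
proof (rule ccontr)
  assume f: "f \<notin> qmodule H G"
  have module: "sphere.T_module (qmodule H G)"
    unfolding sphere.T_module_def using sphere
    by (auto intro: qmodule_mono qmodule.qmodule_add qmodule_ideal_mult)
  obtain \<phi> :: "'v rpoly \<Rightarrow> real" where \<phi>: "\<And>a b. \<phi> (a + b) = \<phi> a + \<phi> b"
    "\<And>a b. \<phi> (a * b) = \<phi> a * \<phi> b" "\<And>r. \<phi> (cst r) = r"
    "\<And>a. a \<in> qmodule H G \<Longrightarrow> 0 \<le> \<phi> a" "\<phi> f \<le> 0"
    using sphere.nonmember_character[OF module f] by blast
  define x where "x = (\<chi> i. \<phi> (pvar i))"
  have eval: "\<phi> p = peval p x" for p
    unfolding x_def by (rule character_is_evaluation[OF \<phi>(1-3)])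
  have "0 < peval f x"
  proof (rule pos)
    fix h assume "h \<in> H"
    then have "h * 1 \<in> qmodule H G" "h * (-1) \<in> qmodule H G"
      using qmodule.qmodule_ideal[of h H] by blast+
    then have "0 \<le> peval (h * 1) x" "0 \<le> peval (h * (-1)) x" using \<phi>(4) eval by metis+
    then show "peval h x = 0" by (simp add: peval_minus)
  next
    fix g assume "g \<in> G"
    then have "g * cst 1 \<in> qmodule H G" by (intro qmodule.qmodule_gen sos_cst) auto
    then show "0 \<le> peval g x" using \<phi>(4) eval by (metis cst_one mult.right_neutral)
  qed
  then show False using \<phi>(5) eval by simp
qed


section \<open>Homogenization\<close>

text \<open>Homogenization to a prescribed degree \<open>d\<close>, meant for \<open>d \<ge> deg p\<close>.\<close>

definition homogenize_at :: "nat \<Rightarrow> 'n::finite rpoly \<Rightarrow> 'n option rpoly" where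
  "homogenize_at d p = (\<Sum>\<alpha>\<in>keys p. Poly_Mapping.single (hom_expo d \<alpha>) (lookup p \<alpha>))"

lemma lookup_cst_mult: "lookup (cst r * p) \<alpha> = r * lookup p \<alpha>"
  unfolding cst_def by (simp flip: mult_map_scale_conv_mult add: map.rep_eq when_def)

lemma keys_cst_mult: "keys (cst r * p) \<subseteq> keys p"
  by (auto simp: in_keys_iff lookup_cst_mult)

lemma keys_diff_scale: "keys (p - cst r * q) \<subseteq> keys p \<union> keys q"
  by (auto simp: in_keys_iff lookup_minus lookup_cst_mult)

lemma homogenize_at_superset:
  assumes "finite S" "keys p \<subseteq> S"
  shows "homogenize_at d p = (\<Sum>\<alpha>\<in>S. Poly_Mapping.single (hom_expo d \<alpha>) (lookup p \<alpha>))"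
  unfolding homogenize_at_def using assms
  by (intro sum.mono_neutral_left) (auto simp: in_keys_iff)

lemma homogenize_at_diff:
  "homogenize_at d (p - q) = homogenize_at d p - homogenize_at d q"
proof -
  have S: "finite (keys p \<union> keys q)" by simp
  have *: "keys (p - q) \<subseteq> keys p \<union> keys q" "keys p \<subseteq> keys p \<union> keys q" "keys q \<subseteq> keys p \<union> keys q"
    by (auto simp: in_keys_iff lookup_minus)
  show ?thesis
    unfolding homogenize_at_superset[OF S *(1)] homogenize_at_superset[OF S *(2)]
      homogenize_at_superset[OF S *(3)]
    by (simp add: lookup_minus single_diff sum_subtractf)
qed

lemma homogenize_at_scale: "homogenize_at d (cst r * p) = cst r * homogenize_at d p"
  unfolding homogenize_at_superset[OF finite_keys keys_cst_mult]
  by (simp add: homogenize_at_def lookup_cst_mult sum_distrib_left) (simp add: cst_def mult_single)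

lemma homogenize_at_single:
  "homogenize_at d (Poly_Mapping.single \<alpha> r) = Poly_Mapping.single (hom_expo d \<alpha>) r"
  by (subst homogenize_at_superset[of "{\<alpha>}"]) auto

lemma peval_homogenize_at:
  assumes "pdeg p \<le> d"
  shows "peval (homogenize_at d p) x = (x $ None) ^ (d - pdeg p) * peval (homogenize p) x"
proof -
  have "monom_eval (hom_expo d \<alpha>) x = (x $ None) ^ (d - pdeg p) * monom_eval (hom_expo (pdeg p) \<alpha>) x"
    if "\<alpha> \<in> keys p" for \<alpha>
  proof -
    have "d - mdeg \<alpha> = (d - pdeg p) + (pdeg p - mdeg \<alpha>)" using assms mdeg_le_pdeg[OF that] by simp
    then show ?thesis by (simp add: monom_eval_def UNIV_option_prod power_add)
  qed
  then show ?thesis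
    by (simp add: homogenize_at_def homogenize_def peval_sum peval_single sum_distrib_left
        mult.left_commute cong: sum.cong)
qed

text \<open>The point with homogeneous coordinates \<open>z\<close>, for \<open>z\<^sub>0 \<noteq> 0\<close>.\<close>

definition affine_part :: "real ^ 'n::finite option \<Rightarrow> real ^ 'n" where
  "affine_part z = (\<chi> i. z $ Some i / z $ None)"

lemma peval_homogenize_at_affine:
  assumes "pdeg p \<le> d" "z $ None \<noteq> 0"
  shows "peval (homogenize_at d p) z = (z $ None) ^ d * peval p (affine_part z)"
  using assms
  by (simp add: peval_homogenize_at peval_homogenize affine_part_def flip: mult.assoc power_add)

text \<open>The vector \<open>(1, x)\<close> of homogeneous coordinates, and its normalization to length 1.\<close>

definition hom_vec :: "real ^ 'n::finite \<Rightarrow> real ^ 'n option" where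
  "hom_vec x = (\<chi> v. case v of None \<Rightarrow> 1 | Some i \<Rightarrow> x $ i)"

definition sphere_point :: "real ^ 'n::finite \<Rightarrow> real ^ 'n option" where
  "sphere_point x = (1 / norm (hom_vec x)) *\<^sub>R hom_vec x"

lemma norm_hom_vec_pos: "0 < norm (hom_vec x)"
proof -
  have "hom_vec x $ None = 1" by (simp add: hom_vec_def)
  then have "hom_vec x \<noteq> 0" by (metis zero_index zero_neq_one)
  then show ?thesis by simp
qed

lemma norm_sphere_point [simp]: "norm (sphere_point x) = 1"
  using norm_hom_vec_pos[of x] by (simp add: sphere_point_def)

lemma sphere_point_None: "sphere_point x $ None = 1 / norm (hom_vec x)"
  by (simp add: sphere_point_def hom_vec_def)

lemma sphere_point_None_pos: "0 < sphere_point x $ None"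
  using norm_hom_vec_pos[of x] by (simp add: sphere_point_None)

lemma affine_part_sphere_point [simp]: "affine_part (sphere_point x) = x"
  using norm_hom_vec_pos[of x]
  by (simp add: affine_part_def sphere_point_def hom_vec_def vec_eq_iff)

lemma hom_set_affine_iff:
  assumes "0 < z $ None"
  shows "z \<in> hom_set c E I \<longleftrightarrow> affine_part z \<in> semialg c E I"
proof -
  have "0 \<le> (z $ None) ^ m * r \<longleftrightarrow> 0 \<le> r" for m r
    using assms by (metis mult_le_cancel_left_pos mult_zero_right zero_less_power)
  then show ?thesis
    using assms by (auto simp: hom_set_def semialg_def peval_homogenize affine_part_def)
qed

lemma sphere_point_in_hom_set: "x \<in> semialg c E I \<Longrightarrow> sphere_point x \<in> hom_set c E I"
  by (simp add: hom_set_affine_iff sphere_point_None_pos)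

lemma closed_hom_set: "closed_at_infinity c E I \<Longrightarrow> closed (hom_set c E I)"
  by (metis closed_at_infinity_def closed_closure)

lemma homogenize_at_nonneg:
  assumes "closed_at_infinity c E I" "pdeg p \<le> d" "\<And>x. x \<in> semialg c E I \<Longrightarrow> 0 \<le> peval p x"
    and "z \<in> hom_set c E I"
  shows "0 \<le> peval (homogenize_at d p) z"
proof (rule continuous_ge_on_closure[where f = "peval (homogenize_at d p)" and x = z])
  show "continuous_on (closure (hom_set c E I \<inter> {x. x $ None > 0})) (peval (homogenize_at d p))"
    by (rule continuous_on_peval)
  show "z \<in> closure (hom_set c E I \<inter> {x. x $ None > 0})"
    using assms(1,4) by (simp add: closed_at_infinity_def)
  show "0 \<le> peval (homogenize_at d p) y" if "y \<in> hom_set c E I \<inter> {x. x $ None > 0}" for y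
    using that assms(2,3) hom_set_affine_iff[of y c E I] by (simp add: peval_homogenize_at_affine)
qed

lemma polys_upto_int: "p \<in> polys_upto (int d) \<longleftrightarrow> pdeg p \<le> d"
  by (auto simp: polys_upto_def)

text \<open>
  The coefficients of \<open>p - t r\<close> are continuous in \<open>t\<close>, so an interior point \<open>p\<close> can be moved a little
  in the direction \<open>-r\<close>.
\<close>

lemma interior_perturb:
  assumes p: "p \<in> poly_topology V interior_of S" and V: "\<And>t. p - cst t * r \<in> V"
  obtains \<delta> where "0 < \<delta>" "p - cst \<delta> * r \<in> S"
proof -
  obtain U where U: "open U" "lookup p \<in> U" "lookup -` U \<inter> V \<subseteq> S"
    using p by (auto simp: interior_of_def poly_topology_def openin_pullback_topology)
  have "continuous_on UNIV (\<lambda>t. lookup (p - cst t * r))"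
    by (intro continuous_on_coordinatewise_then_product)
      (simp add: lookup_minus lookup_cst_mult, intro continuous_intros)
  then have "open ((\<lambda>t. lookup (p - cst t * r)) -` U)"
    using U(1) by (rule open_vimage[rotated])
  moreover have "0 \<in> (\<lambda>t. lookup (p - cst t * r)) -` U" using U(2) by simp
  ultimately obtain e where e: "0 < e" "ball 0 e \<subseteq> (\<lambda>t. lookup (p - cst t * r)) -` U"
    by (meson open_contains_ball)
  then have "e / 2 \<in> (\<lambda>t. lookup (p - cst t * r)) -` U" by (intro subsetD[OF e(2)]) simp
  then show ?thesis using that[of "e / 2"] e(1) U(3) V by auto
qed

lemma pdeg_diff_scale_le: "pdeg p \<le> d \<Longrightarrow> pdeg r \<le> d \<Longrightarrow> pdeg (p - cst t * r) \<le> d"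
  unfolding pdeg_le_iff by (auto simp: in_keys_iff lookup_minus lookup_cst_mult)

text \<open>
  An interior point of the cone of nonnegative polynomials stays positive at infinity:
  if \<open>z\<^sub>v \<noteq> 0\<close>, a multiple of the monomial with homogenization \<open>x\<^sub>v\<^sup>d\<close> can be subtracted from it, with
  the sign for which this homogenization is positive at \<open>z\<close>.
\<close>

lemma homogenize_at_interior_pos:
  assumes cl: "closed_at_infinity c E I"
    and q: "q \<in> poly_topology (polys_upto (int d)) interior_of
      nonneg_polys (polys_upto (int d)) (semialg c E I)"
    and z: "z \<in> hom_set c E I" "z \<noteq> 0"
  shows "0 < peval (homogenize_at d q) z"
proof -
  obtain v where v: "z $ v \<noteq> 0" using z(2) by (auto simp: vec_eq_iff)
  have q_deg: "pdeg q \<le> d"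
    using q interior_of_subset by (fastforce simp: nonneg_polys_def polys_upto_int)
  define \<alpha> :: "'b expo" where "\<alpha> = (case v of None \<Rightarrow> 0 | Some i \<Rightarrow> Poly_Mapping.single i d)"
  have mdeg_single: "mdeg (Poly_Mapping.single i d) = d" for i :: 'b
  proof -
    have "mdeg (Poly_Mapping.single i d) = (\<Sum>j\<in>UNIV. if j = i then d else 0)"
      unfolding mdeg_def by (intro sum.cong) (auto simp: lookup_single when_def)
    then show ?thesis by simp
  qed
  have "mdeg (0 :: 'b expo) = 0" by (simp add: mdeg_def)
  then have \<alpha>_deg: "mdeg \<alpha> \<le> d" by (auto simp: \<alpha>_def mdeg_single split: option.split)
  have \<alpha>_hom: "hom_expo d \<alpha> = Poly_Mapping.single v d"
    by (rule poly_mapping_eqI, rename_tac w, case_tac w; cases v)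
      (auto simp: \<alpha>_def mdeg_single lookup_single when_def \<open>mdeg 0 = 0\<close>)
  define r where "r = Poly_Mapping.single \<alpha> (sgn ((z $ v) ^ d))"
  have r_deg: "pdeg r \<le> d" using \<alpha>_deg by (auto simp: r_def pdeg_le_iff)
  have r_eval: "peval (homogenize_at d r) z = \<bar>(z $ v) ^ d\<bar>"
    by (simp add: r_def homogenize_at_single \<alpha>_hom peval_single monom_eval_single abs_sgn mult.commute)
  obtain \<delta> where \<delta>: "0 < \<delta>" "q - cst \<delta> * r \<in> nonneg_polys (polys_upto (int d)) (semialg c E I)"
    by (rule interior_perturb[OF q, of r])
      (simp_all add: polys_upto_int pdeg_diff_scale_le q_deg r_deg)
  then have "0 \<le> peval (homogenize_at d (q - cst \<delta> * r)) z"
    by (intro homogenize_at_nonneg[OF cl _ _ z(1)] pdeg_diff_scale_le q_deg r_deg)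
      (auto simp: nonneg_polys_def)
  then have "\<delta> * \<bar>(z $ v) ^ d\<bar> \<le> peval (homogenize_at d q) z"
    by (simp add: homogenize_at_diff homogenize_at_scale peval_diff peval_mult r_eval)
  moreover have "0 < \<delta> * \<bar>(z $ v) ^ d\<bar>" using \<delta>(1) v by simp
  ultimately show ?thesis by linarith
qed


section \<open>Truncated quadratic modules\<close>

lemma polys_upto_zero: "0 \<in> polys_upto s"
  by (simp add: polys_upto_def)

lemma polys_upto_add: "p \<in> polys_upto s \<Longrightarrow> q \<in> polys_upto s \<Longrightarrow> p + q \<in> polys_upto s"
proof -
  have "pdeg (p + q) \<le> max (pdeg p) (pdeg q)"
    unfolding pdeg_le_iff using keys_add[of p q] by (force dest: mdeg_le_pdeg)
  then show "p \<in> polys_upto s \<Longrightarrow> q \<in> polys_upto s \<Longrightarrow> p + q \<in> polys_upto s"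
    by (auto simp: polys_upto_def)
qed

lemma sos_upto_eq: "sos_upto s = polys_upto s \<inter> sos"
  by (auto simp: sos_upto_def sos_def)

lemma trunc_ideal_zero: "0 \<in> trunc_ideal k H"
  unfolding trunc_ideal_def by (intro CollectI exI[of _ "\<lambda>_. 0"]) (simp add: polys_upto_zero)

lemma trunc_ideal_add: "a \<in> trunc_ideal k H \<Longrightarrow> b \<in> trunc_ideal k H \<Longrightarrow> a + b \<in> trunc_ideal k H"
proof -
  assume "a \<in> trunc_ideal k H" "b \<in> trunc_ideal k H"
  then obtain u v where "a = (\<Sum>h\<in>H. h * u h)" "b = (\<Sum>h\<in>H. h * v h)"
    "\<forall>h\<in>H. u h \<in> polys_upto (2 * int k - int (pdeg h))"
    "\<forall>h\<in>H. v h \<in> polys_upto (2 * int k - int (pdeg h))"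
    by (auto simp: trunc_ideal_def)
  then show "a + b \<in> trunc_ideal k H"
    unfolding trunc_ideal_def
    by (intro CollectI exI[of _ "\<lambda>h. u h + v h"])
      (simp add: sum.distrib distrib_left polys_upto_add)
qed

lemma trunc_ideal_generator:
  assumes "finite H" "h \<in> H" "u \<in> polys_upto (2 * int k - int (pdeg h))"
  shows "h * u \<in> trunc_ideal k H"
proof -
  have "(\<Sum>g\<in>H. g * (if g = h then u else 0)) = (\<Sum>g\<in>H. if g = h then h * u else 0)"
    by (intro sum.cong) auto
  then have "h * u = (\<Sum>g\<in>H. g * (if g = h then u else 0))" using assms by simp
  then show ?thesis
    unfolding trunc_ideal_def using assms
    by (intro CollectI exI[of _ "\<lambda>g. if g = h then u else 0"]) (auto simp: polys_upto_zero)
qed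

lemma trunc_qm_sos: "s \<in> sos_upto (2 * int k) \<Longrightarrow> s \<in> trunc_qm k G"
  unfolding trunc_qm_def
  by (intro CollectI exI[of _ s] exI[of _ "\<lambda>_. 0"]) (simp add: sos_upto_eq polys_upto_zero sos_zero)

lemma trunc_qm_add: "a \<in> trunc_qm k G \<Longrightarrow> b \<in> trunc_qm k G \<Longrightarrow> a + b \<in> trunc_qm k G"
proof -
  assume "a \<in> trunc_qm k G" "b \<in> trunc_qm k G"
  then obtain s s' t t' where "a = s + (\<Sum>g\<in>G. g * s' g)" "b = t + (\<Sum>g\<in>G. g * t' g)"
    "s \<in> sos_upto (2 * int k)" "t \<in> sos_upto (2 * int k)"
    "\<forall>g\<in>G. s' g \<in> sos_upto (2 * int k - 2 * \<lceil>real (pdeg g) / 2\<rceil>)"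
    "\<forall>g\<in>G. t' g \<in> sos_upto (2 * int k - 2 * \<lceil>real (pdeg g) / 2\<rceil>)"
    by (auto simp: trunc_qm_def)
  then show "a + b \<in> trunc_qm k G"
    unfolding trunc_qm_def
    by (intro CollectI exI[of _ "s + t"] exI[of _ "\<lambda>g. s' g + t' g"])
      (simp add: sum.distrib distrib_left sos_upto_eq polys_upto_add sos_add)
qed

lemma trunc_qm_generator:
  assumes "finite G" "g \<in> G" "s \<in> sos_upto (2 * int k - 2 * \<lceil>real (pdeg g) / 2\<rceil>)"
  shows "g * s \<in> trunc_qm k G"
proof -
  have "(\<Sum>h\<in>G. h * (if h = g then s else 0)) = (\<Sum>h\<in>G. if h = g then g * s else 0)"
    by (intro sum.cong) auto
  then have "g * s = 0 + (\<Sum>h\<in>G. h * (if h = g then s else 0))" using assms by simp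
  then show ?thesis
    unfolding trunc_qm_def using assms
    by (intro CollectI exI[of _ 0] exI[of _ "\<lambda>h. if h = g then s else 0"])
      (auto simp: sos_upto_eq polys_upto_zero sos_zero)
qed

text \<open>An element of the quadratic module has a representation within every large enough degree bound.\<close>

lemma qmodule_truncated:
  assumes "finite H" "finite G" "a \<in> qmodule H G"
  shows "\<exists>k0. \<forall>k\<ge>k0. \<exists>f\<in>trunc_ideal k H. \<exists>g\<in>trunc_qm k G. a = f + g"
  using assms(3)
proof induction
  case (qmodule_sos s)
  have "s \<in> trunc_qm k G" if "pdeg s \<le> k" for k
    using qmodule_sos that by (intro trunc_qm_sos) (auto simp: sos_upto_eq polys_upto_def)
  then show ?case using trunc_ideal_zero by (metis add_0)
next
  case (qmodule_gen g s)
  have "g * s \<in> trunc_qm k G" if "pdeg g + pdeg s \<le> k" for k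
  proof (rule trunc_qm_generator[OF assms(2) qmodule_gen(1)])
    have "\<lceil>real (pdeg g) / 2\<rceil> \<le> int (pdeg g)" by (simp add: ceiling_le_iff)
    then show "s \<in> sos_upto (2 * int k - 2 * \<lceil>real (pdeg g) / 2\<rceil>)"
      using qmodule_gen(2) that by (auto simp: sos_upto_eq polys_upto_def)
  qed
  then show ?case using trunc_ideal_zero by (metis add_0)
next
  case (qmodule_ideal h u)
  have "h * u \<in> trunc_ideal k H" if "pdeg h + pdeg u \<le> k" for k
    using that by (intro trunc_ideal_generator assms(1) qmodule_ideal) (auto simp: polys_upto_def)
  moreover have "0 \<in> trunc_qm k G" for k
    by (intro trunc_qm_sos) (simp add: sos_upto_eq polys_upto_zero sos_zero)
  ultimately show ?case by (metis add_0_right)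
next
  case (qmodule_add a b)
  then obtain k0 k1 where k0: "\<forall>k\<ge>k0. \<exists>f\<in>trunc_ideal k H. \<exists>g\<in>trunc_qm k G. a = f + g"
    and k1: "\<forall>k\<ge>k1. \<exists>f\<in>trunc_ideal k H. \<exists>g\<in>trunc_qm k G. b = f + g" by blast
  have "\<exists>f\<in>trunc_ideal k H. \<exists>g\<in>trunc_qm k G. a + b = f + g" if k: "max k0 k1 \<le> k" for k
  proof -
    obtain f g f' g' where "f \<in> trunc_ideal k H" "g \<in> trunc_qm k G" "a = f + g"
      "f' \<in> trunc_ideal k H" "g' \<in> trunc_qm k G" "b = f' + g'"
      using k0 k1 k by (metis max.bounded_iff)
    then show ?thesis
      by (intro bexI[of _ "f + f'"] bexI[of _ "g + g'"] trunc_ideal_add trunc_qm_add)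
        (simp_all add: algebra_simps)
  qed
  then show ?case by blast
qed

lemma trunc_sum_nonneg:
  assumes "f \<in> trunc_ideal k H" "g \<in> trunc_qm k G"
    and "\<And>h. h \<in> H \<Longrightarrow> peval h x = 0" "\<And>g. g \<in> G \<Longrightarrow> 0 \<le> peval g x"
  shows "0 \<le> peval (f + g) x"
proof -
  have "peval f x = 0"
    using assms(1,3) by (auto simp: trunc_ideal_def peval_sum peval_mult)
  moreover have "0 \<le> peval g x"
    using assms(2,4)
    by (auto simp: trunc_qm_def peval_sum peval_mult peval_add sos_upto_eq peval_sos_nonneg
        intro!: add_nonneg_nonneg sum_nonneg mult_nonneg_nonneg)
  ultimately show ?thesis by (simp add: peval_add)
qed


section \<open>Sums of squares approximations\<close>

text \<open>The homogenized constraints, including the sphere equation and \<open>x\<^sub>0 \<ge> 0\<close>.\<close>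

definition hom_eqs :: "('l \<Rightarrow> 'n::finite rpoly) \<Rightarrow> 'l set \<Rightarrow> 'n option rpoly set" where
  "hom_eqs c E = insert sphere_poly ((\<lambda>i. homogenize (c i)) ` E)"

definition hom_ineqs :: "('l \<Rightarrow> 'n::finite rpoly) \<Rightarrow> 'l set \<Rightarrow> 'n option rpoly set" where
  "hom_ineqs c I = insert (pvar None) ((\<lambda>j. homogenize (c j)) ` I)"

lemma finite_hom_constraints:
  "finite E \<Longrightarrow> finite I \<Longrightarrow> finite (hom_eqs c E) \<and> finite (hom_ineqs c I)"
  by (simp add: hom_eqs_def hom_ineqs_def)

lemma hom_constraints_iff:
  "(\<forall>h\<in>hom_eqs c E. peval h z = 0) \<and> (\<forall>g\<in>hom_ineqs c I. 0 \<le> peval g z) \<longleftrightarrow>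
    z \<in> hom_set c E I \<and> norm z = 1"
  by (auto simp: hom_eqs_def hom_ineqs_def hom_set_def peval_sphere_poly abs_square_eq_1)

lemma positive_homogeneous_in_qmodule:
  assumes "\<And>z. z \<in> hom_set c E I \<Longrightarrow> norm z = 1 \<Longrightarrow> 0 < peval f z"
  shows "f \<in> qmodule (hom_eqs c E) (hom_ineqs c I)"
proof (rule positive_on_sphere_in_qmodule)
  fix z assume "\<And>h. h \<in> hom_eqs c E \<Longrightarrow> peval h z = 0" "\<And>g. g \<in> hom_ineqs c I \<Longrightarrow> 0 \<le> peval g z"
  then show "0 < peval f z" using assms[of z] hom_constraints_iff[of c E z I] by blast
qed (simp add: hom_eqs_def)

lemma sos_approx_subset: "sos_approx c E I A k \<subseteq> nonneg_polys (polys_on A) (semialg c E I)"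
proof
  fix p assume "p \<in> sos_approx c E I A k"
  then obtain f g where p: "p \<in> polys_on A" "homogenize p = f + g"
    "f \<in> trunc_ideal k (hom_eqs c E)" "g \<in> trunc_qm k (hom_ineqs c I)"
    by (auto simp: sos_approx_def hom_eqs_def hom_ineqs_def)
  have "0 \<le> peval p x" if x: "x \<in> semialg c E I" for x
  proof -
    have "0 \<le> peval (homogenize p) (sphere_point x)"
      unfolding p(2) using trunc_sum_nonneg[OF p(3,4)]
        hom_constraints_iff[of c E "sphere_point x" I] sphere_point_in_hom_set[OF x]
        norm_sphere_point[of x] by blast
    then show ?thesis
      using sphere_point_None_pos[of x] affine_part_sphere_point[of x]
      by (simp add: peval_homogenize affine_part_def zero_le_mult_iff) (metis not_le zero_less_power)
  qed
  then show "p \<in> nonneg_polys (polys_on A) (semialg c E I)" using p(1) by (simp add: nonneg_polys_def)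
qed

text \<open>
  Although \<open>homogenize p\<close> uses the degree of \<open>p\<close>, its positivity follows from that of the homogenization
  to degree \<open>d\<close>, from which it differs by a power of \<open>x\<^sub>0\<close>.
\<close>

lemma interior_subset_sos_approx:
  assumes fin: "finite E" "finite I" "finite A"
    and cl: "closed_at_infinity c E I"
    and q: "q \<in> polys_on A" "q \<in> poly_topology (polys_upto (int (set_deg A))) interior_of
      nonneg_polys (polys_upto (int (set_deg A))) (semialg c E I)"
    and p: "p \<in> poly_topology (polys_on A) interior_of nonneg_polys (polys_on A) (semialg c E I)"
  shows "\<exists>k\<ge>1. p \<in> sos_approx c E I A k"
proof -
  define d where "d = set_deg A"
  have deg: "pdeg r \<le> d" if "r \<in> polys_on A" for r
    using that fin(3) by (auto simp: polys_on_def pdeg_le_iff d_def intro: mdeg_le_set_deg)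
  have p_A: "p \<in> polys_on A"
    using p interior_of_subset by (fastforce simp: nonneg_polys_def)
  have "p - cst t * q \<in> polys_on A" for t
    using p_A q(1) keys_diff_scale[of p t q] by (auto simp: polys_on_def)
  then obtain \<epsilon> where \<epsilon>: "0 < \<epsilon>" "p - cst \<epsilon> * q \<in> nonneg_polys (polys_on A) (semialg c E I)"
    using interior_perturb[OF p, of q] by blast
  have "0 < peval (homogenize p) z" if z: "z \<in> hom_set c E I" "norm z = 1" for z
  proof -
    have "0 \<le> peval (homogenize_at d (p - cst \<epsilon> * q)) z"
      using \<epsilon>(2) by (intro homogenize_at_nonneg[OF cl _ _ z(1)] deg) (auto simp: nonneg_polys_def)
    moreover have "0 < peval (homogenize_at d q) z"
      using z q(2) unfolding d_def by (intro homogenize_at_interior_pos[OF cl]) auto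
    ultimately have "0 < peval (homogenize_at d p) z"
      using mult_pos_pos[OF \<epsilon>(1)]
      by (simp add: homogenize_at_diff homogenize_at_scale peval_diff peval_mult) (meson less_le_trans)
    moreover have "0 \<le> (z $ None) ^ (d - pdeg p)" using z(1) by (simp add: hom_set_def)
    ultimately show ?thesis
      unfolding peval_homogenize_at[OF deg[OF p_A]] by (metis mult_nonneg_nonpos not_le)
  qed
  then have "homogenize p \<in> qmodule (hom_eqs c E) (hom_ineqs c I)"
    by (rule positive_homogeneous_in_qmodule)
  then obtain k0 where "\<forall>k\<ge>k0. \<exists>f\<in>trunc_ideal k (hom_eqs c E). \<exists>g\<in>trunc_qm k (hom_ineqs c I).
      homogenize p = f + g"
    using qmodule_truncated[of "hom_eqs c E" "hom_ineqs c I"] finite_hom_constraints[OF fin(1,2)]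
    by meson
  then have "p \<in> sos_approx c E I A (max 1 k0)"
    using p_A unfolding sos_approx_def hom_eqs_def hom_ineqs_def
    by (simp add: Bex_def)
  then show ?thesis by (intro exI[of _ "max 1 k0"]) simp
qed


section \<open>Separation from a closed convex cone\<close>

lemma nonneg_if_quadratic_nonneg:
  fixes a b :: real
  assumes "\<And>t. 0 < t \<Longrightarrow> t \<le> 1 \<Longrightarrow> 0 \<le> 2 * t * a + t\<^sup>2 * b"
  shows "0 \<le> a"
proof (rule ccontr)
  assume a: "\<not> 0 \<le> a"
  define t where "t = min 1 (- a / (\<bar>b\<bar> + 1))"
  have t: "0 < t" "t \<le> 1" using a by (auto simp: t_def divide_neg_pos)
  have "t \<le> - a / (\<bar>b\<bar> + 1)" unfolding t_def by (rule min.cobounded2)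
  then have ta: "t * (\<bar>b\<bar> + 1) \<le> - a" by (subst (asm) pos_le_divide_eq) auto
  have "t * b \<le> t * (\<bar>b\<bar> + 1)" using t(1) by (intro mult_left_mono) auto
  then have "2 * a + t * b < 0" using ta a by linarith
  then have "t * (2 * a + t * b) < 0" using t(1) by (simp add: mult_pos_neg)
  then show False using assms[OF t(1,2)] by (simp add: power2_eq_square algebra_simps)
qed

text \<open>
  The separating functional is \<open>m - y\<close>, where \<open>m\<close> is a point of the closed cone nearest to \<open>y\<close>.
\<close>

lemma cone_separation:
  fixes C :: "('a \<Rightarrow> real) set"
  assumes A: "finite A" and C_sub: "C \<subseteq> A \<rightarrow>\<^sub>E UNIV"
    and C_zero: "(\<lambda>\<alpha>\<in>A. 0) \<in> C"
    and C_comb: "\<And>z c s t. z \<in> C \<Longrightarrow> c \<in> C \<Longrightarrow> 0 \<le> s \<Longrightarrow> 0 \<le> t \<Longrightarrow> (\<lambda>\<alpha>\<in>A. s * z \<alpha> + t * c \<alpha>) \<in> C"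
    and y: "y \<in> A \<rightarrow>\<^sub>E UNIV" "y \<notin> product_topology (\<lambda>_. euclideanreal) A closure_of C"
  obtains p where "\<And>z. z \<in> C \<Longrightarrow> 0 \<le> (\<Sum>\<alpha>\<in>A. p \<alpha> * z \<alpha>)" "(\<Sum>\<alpha>\<in>A. p \<alpha> * y \<alpha>) < 0"
proof -
  define X where "X = product_topology (\<lambda>_::'a. euclideanreal) A"
  define D where "D = X closure_of C"
  have topX: "topspace X = A \<rightarrow>\<^sub>E UNIV" by (simp add: X_def)
  have D_sub: "D \<subseteq> A \<rightarrow>\<^sub>E UNIV" unfolding D_def topX[symmetric] by (rule closure_of_subset_topspace)
  have C_D: "C \<subseteq> D" unfolding D_def using C_sub by (intro closure_of_subset) (simp add: topX)
  have D_comb: "(\<lambda>\<alpha>\<in>A. s * z \<alpha> + t * c \<alpha>) \<in> D" if z: "z \<in> D" and c: "c \<in> C" and st: "0 \<le> s" "0 \<le> t"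
    for z c s t
  proof -
    let ?f = "\<lambda>z. \<lambda>\<alpha>\<in>A. s * z \<alpha> + t * c \<alpha>"
    have "continuous_map X euclideanreal (\<lambda>x. ?f x \<alpha>)" if "\<alpha> \<in> A" for \<alpha>
      unfolding X_def using that by (simp, intro continuous_intros) auto
    then have "continuous_map X X ?f"
      by (subst (2) X_def, subst continuous_map_componentwise) auto
    then have "?f ` D \<subseteq> X closure_of (?f ` C)"
      unfolding D_def by (rule continuous_map_image_closure_subset)
    also have "\<dots> \<subseteq> D"
      unfolding D_def using C_comb[OF _ c st] by (intro closure_of_mono) auto
    finally show ?thesis using z by blast
  qed
  define f where "f z = (\<Sum>\<alpha>\<in>A. (z \<alpha> - y \<alpha>)\<^sup>2)" for z :: "'a \<Rightarrow> real"
  have f_cont: "continuous_map X euclideanreal f"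
    unfolding f_def X_def by (intro continuous_intros A) auto
  let ?z0 = "\<lambda>\<alpha>\<in>A. 0::real"
  define B where "B = (\<Pi>\<^sub>E \<alpha>\<in>A. {y \<alpha> - sqrt (f ?z0)..y \<alpha> + sqrt (f ?z0)})"
  have in_B: "z \<in> B" if "z \<in> D" "f z \<le> f ?z0" for z
  proof -
    have "\<bar>z \<alpha> - y \<alpha>\<bar> \<le> sqrt (f ?z0)" if \<alpha>: "\<alpha> \<in> A" for \<alpha>
    proof -
      have "(z \<alpha> - y \<alpha>)\<^sup>2 \<le> f z"
        unfolding f_def using A \<alpha> by (intro member_le_sum) auto
      then show ?thesis using \<open>f z \<le> f ?z0\<close> by (intro real_le_rsqrt) simp
    qed
    then show ?thesis using that(1) D_sub unfolding B_def by (force simp: PiE_iff abs_le_iff)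
  qed
  have "compactin X B" unfolding X_def B_def by (simp add: compactin_PiE)
  then have "compactin X (D \<inter> B)" unfolding D_def by (intro closed_Int_compactin) auto
  then have "compact (f ` (D \<inter> B))" using image_compactin[OF _ f_cont] by simp
  moreover have "?z0 \<in> D \<inter> B" using C_zero C_D in_B by blast
  ultimately obtain m where m: "m \<in> D \<inter> B" "\<And>z. z \<in> D \<inter> B \<Longrightarrow> f m \<le> f z"
    using compact_attains_inf[of "f ` (D \<inter> B)"] by blast
  have min: "f m \<le> f z" if "z \<in> D" for z
    using m(2)[of z] m(2)[OF \<open>?z0 \<in> D \<inter> B\<close>] in_B[OF that] that by (meson IntI order_trans linear)
  define p where "p \<alpha> = m \<alpha> - y \<alpha>" for \<alpha>
  have variation: "0 \<le> 2 * t * (\<Sum>\<alpha>\<in>A. p \<alpha> * v \<alpha>) + t\<^sup>2 * (\<Sum>\<alpha>\<in>A. (v \<alpha>)\<^sup>2)"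
    if D: "(\<lambda>\<alpha>\<in>A. m \<alpha> + t * v \<alpha>) \<in> D" for t v
  proof -
    have "f (\<lambda>\<alpha>\<in>A. m \<alpha> + t * v \<alpha>) = (\<Sum>\<alpha>\<in>A. (p \<alpha>)\<^sup>2 + 2 * t * (p \<alpha> * v \<alpha>) + t\<^sup>2 * (v \<alpha>)\<^sup>2)"
      unfolding f_def by (intro sum.cong) (auto simp: p_def power2_eq_square algebra_simps)
    also have "\<dots> = f m + 2 * t * (\<Sum>\<alpha>\<in>A. p \<alpha> * v \<alpha>) + t\<^sup>2 * (\<Sum>\<alpha>\<in>A. (v \<alpha>)\<^sup>2)"
      by (simp add: f_def p_def sum.distrib sum_distrib_left)
    finally show ?thesis using min[OF D] by simp
  qed
  have nonneg: "0 \<le> (\<Sum>\<alpha>\<in>A. p \<alpha> * c \<alpha>)" if c: "c \<in> C" for c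
  proof (rule nonneg_if_quadratic_nonneg)
    fix t :: real assume t: "0 < t"
    have "(\<lambda>\<alpha>\<in>A. 1 * m \<alpha> + t * c \<alpha>) \<in> D" using m(1) c t by (intro D_comb) auto
    then show "0 \<le> 2 * t * (\<Sum>\<alpha>\<in>A. p \<alpha> * c \<alpha>) + t\<^sup>2 * (\<Sum>\<alpha>\<in>A. (c \<alpha>)\<^sup>2)"
      by (intro variation) simp
  qed
  have "0 \<le> (\<Sum>\<alpha>\<in>A. p \<alpha> * - m \<alpha>)"
  proof (rule nonneg_if_quadratic_nonneg)
    fix t :: real assume t: "0 < t" "t \<le> 1"
    have "(\<lambda>\<alpha>\<in>A. (1 - t) * m \<alpha> + 0 * ?z0 \<alpha>) \<in> D"
      by (rule D_comb[OF IntD1[OF m(1)] C_zero]) (use t in auto)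
    also have "(\<lambda>\<alpha>\<in>A. (1 - t) * m \<alpha> + 0 * ?z0 \<alpha>) = (\<lambda>\<alpha>\<in>A. m \<alpha> + t * - m \<alpha>)"
      by (auto simp: fun_eq_iff algebra_simps)
    finally show "0 \<le> 2 * t * (\<Sum>\<alpha>\<in>A. p \<alpha> * - m \<alpha>) + t\<^sup>2 * (\<Sum>\<alpha>\<in>A. (- m \<alpha>)\<^sup>2)"
      by (rule variation)
  qed
  then have "(\<Sum>\<alpha>\<in>A. p \<alpha> * m \<alpha>) \<le> 0" by (simp add: sum_negf)
  moreover have "0 < (\<Sum>\<alpha>\<in>A. (p \<alpha>)\<^sup>2)"
  proof -
    have "m \<in> A \<rightarrow>\<^sub>E UNIV" "m \<noteq> y" using m(1) D_sub y(2) by (auto simp: D_def X_def)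
    then obtain \<alpha> where "\<alpha> \<in> A" "p \<alpha> \<noteq> 0"
      using y(1) unfolding p_def by (metis PiE_ext right_minus_eq)
    then show ?thesis using A by (intro sum_pos2) auto
  qed
  moreover have "(\<Sum>\<alpha>\<in>A. p \<alpha> * y \<alpha>) = (\<Sum>\<alpha>\<in>A. p \<alpha> * m \<alpha>) - (\<Sum>\<alpha>\<in>A. (p \<alpha>)\<^sup>2)"
    unfolding sum_subtractf[symmetric]
    by (intro sum.cong) (auto simp: p_def power2_eq_square algebra_simps)
  ultimately show ?thesis using that[OF nonneg] by linarith
qed


section \<open>Moments of measures\<close>

text \<open>Moment vectors of finitely supported measures on \<open>K\<close>.\<close>

definition atomic_moments :: "'n::finite expo set \<Rightarrow> (real ^ 'n) set \<Rightarrow> ('n expo \<Rightarrow> real) set" where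
  "atomic_moments A K = {y. \<exists>F c. finite F \<and> F \<subseteq> K \<and> (\<forall>x\<in>F. 0 \<le> c x) \<and>
     y = (\<lambda>\<alpha>\<in>A. \<Sum>x\<in>F. c x * monom_eval \<alpha> x)}"

lemma atomic_moments_subset: "atomic_moments A K \<subseteq> moment_cone A K"
proof
  fix y assume "y \<in> atomic_moments A K"
  then obtain F c where F: "finite F" "F \<subseteq> K" "\<forall>x\<in>F. 0 \<le> c x"
    and y: "y = (\<lambda>\<alpha>\<in>A. \<Sum>x\<in>F. c x * monom_eval \<alpha> x)"
    by (auto simp: atomic_moments_def)
  define P where "P = point_measure F (\<lambda>x. ennreal (c x))"
  define M where "M = distr P borel (\<lambda>x. x)"
  have meas: "(\<lambda>x. x) \<in> measurable P borel" by (simp add: P_def)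
  have "measure_support M \<subseteq> K"
  proof
    fix x assume x: "x \<in> measure_support M"
    have "emeasure M (- F) = emeasure P ((\<lambda>x. x) -` (- F) \<inter> space P)"
      unfolding M_def using meas finite_imp_closed[OF F(1)]
      by (intro emeasure_distr) (auto intro: borel_open)
    also have "(\<lambda>x. x) -` (- F) \<inter> space P = {}" by (auto simp: P_def space_point_measure)
    finally have "emeasure M (- F) = 0" by simp
    moreover have "open (- F)" using finite_imp_closed[OF F(1)] by auto
    ultimately show "x \<in> K" using x F(2) unfolding measure_support_def by blast
  qed
  moreover have "has_bochner_integral M (monom_eval \<alpha>) (y \<alpha>)" if "\<alpha> \<in> A" for \<alpha>
  proof -
    have mono: "monom_eval \<alpha> \<in> borel_measurable borel"
      by (intro borel_measurable_continuous_onI continuous_on_monom_eval)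
    have "integrable M (monom_eval \<alpha>)"
      unfolding M_def integrable_distr_eq[OF meas mono] unfolding P_def
      by (intro integrable_point_measure_finite F(1))
    moreover have "integral\<^sup>L M (monom_eval \<alpha>) = y \<alpha>"
      unfolding M_def integral_distr[OF meas mono] unfolding P_def
      using F that by (subst lebesgue_integral_point_measure_finite) (auto simp: y)
    ultimately show ?thesis by (simp add: has_bochner_integral_iff)
  qed
  moreover have "sets M = sets borel" by (simp add: M_def)
  ultimately show "y \<in> moment_cone A K" unfolding moment_cone_def using y by auto
qed

lemma atomic_moments_zero: "(\<lambda>\<alpha>\<in>A. 0) \<in> atomic_moments A K"
  unfolding atomic_moments_def by (intro CollectI exI[of _ "{}"]) auto

lemma atomic_moments_point: "x \<in> K \<Longrightarrow> (\<lambda>\<alpha>\<in>A. monom_eval \<alpha> x) \<in> atomic_moments A K"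
  unfolding atomic_moments_def by (intro CollectI exI[of _ "{x}"] exI[of _ "\<lambda>_. 1"]) auto

lemma atomic_moments_combination:
  assumes "z \<in> atomic_moments A K" "z' \<in> atomic_moments A K" "0 \<le> s" "0 \<le> t"
  shows "(\<lambda>\<alpha>\<in>A. s * z \<alpha> + t * z' \<alpha>) \<in> atomic_moments A K"
proof -
  obtain F c F' c' where F: "finite F" "F \<subseteq> K" "\<forall>x\<in>F. 0 \<le> c x"
    and z: "z = (\<lambda>\<alpha>\<in>A. \<Sum>x\<in>F. c x * monom_eval \<alpha> x)"
    and F': "finite F'" "F' \<subseteq> K" "\<forall>x\<in>F'. 0 \<le> c' x"
    and z': "z' = (\<lambda>\<alpha>\<in>A. \<Sum>x\<in>F'. c' x * monom_eval \<alpha> x)"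
    using assms(1,2) by (auto simp: atomic_moments_def)
  define e where "e x = (if x \<in> F then s * c x else 0) + (if x \<in> F' then t * c' x else 0)" for x
  have "s * z \<alpha> + t * z' \<alpha> = (\<Sum>x\<in>F \<union> F'. e x * monom_eval \<alpha> x)" if "\<alpha> \<in> A" for \<alpha>
  proof -
    have "s * z \<alpha> = (\<Sum>x\<in>F \<union> F'. (if x \<in> F then s * c x else 0) * monom_eval \<alpha> x)"
      using F(1) F'(1) that unfolding z
      by (simp add: sum_distrib_left mult.assoc, intro sum.mono_neutral_cong_left) auto
    moreover have "t * z' \<alpha> = (\<Sum>x\<in>F \<union> F'. (if x \<in> F' then t * c' x else 0) * monom_eval \<alpha> x)"
      using F(1) F'(1) that unfolding z'
      by (simp add: sum_distrib_left mult.assoc, intro sum.mono_neutral_cong_left) auto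
    ultimately show ?thesis by (simp add: e_def distrib_right sum.distrib)
  qed
  then have "(\<lambda>\<alpha>\<in>A. s * z \<alpha> + t * z' \<alpha>) = (\<lambda>\<alpha>\<in>A. \<Sum>x\<in>F \<union> F'. e x * monom_eval \<alpha> x)"
    by (auto simp: fun_eq_iff)
  then show ?thesis
    unfolding atomic_moments_def using F F' assms(3,4)
    by (intro CollectI exI[of _ "F \<union> F'"] exI[of _ e]) (auto simp: e_def)
qed

text \<open>
  The complement of the support is null, because a union of null open sets reduces to a countable one.
\<close>

lemma AE_measure_support:
  fixes M :: "'a::second_countable_topology measure"
  assumes "sets M = sets borel"
  shows "AE x in M. x \<in> measure_support M"
proof -
  define \<F> where "\<F> = {U. open U \<and> emeasure M U = 0}"
  obtain \<G> where \<G>: "\<G> \<subseteq> \<F>" "countable \<G>" "\<Union>\<G> = \<Union>\<F>"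
    using Lindelof[of \<F>] by (auto simp: \<F>_def)
  have "(\<Union>U\<in>\<G>. U) \<in> null_sets M"
    using \<G>(1) assms
    by (intro null_sets_UN' \<G>(2)) (auto simp: \<F>_def null_sets_def)
  moreover have "{x\<in>space M. x \<notin> measure_support M} \<subseteq> (\<Union>U\<in>\<G>. U)"
    using \<G>(3) by (auto simp: \<F>_def measure_support_def)
  ultimately show ?thesis by (rule AE_I')
qed


section \<open>Feasible vectors of the relaxations\<close>

text \<open>
  The matrix conditions of the \<open>k\<close>-th relaxation say that the Riesz functional is nonnegative on
  the following polynomials. Equations are tested with both signs.
\<close>

definition test_polys :: "nat \<Rightarrow> 'v::finite rpoly set \<Rightarrow> 'v rpoly set \<Rightarrow> 'v rpoly set" where
  "test_polys k H G =
    {h * Poly_Mapping.single (\<beta> + \<gamma>) e | h \<beta> \<gamma> e.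
       h \<in> H \<and> \<beta> \<in> loc_index k h \<and> \<gamma> \<in> loc_index k h \<and> e \<in> {1, -1}} \<union>
    {g * p\<^sup>2 | g p. g \<in> insert 1 G \<and> keys p \<subseteq> loc_index k g}"

lemma riesz_single: "riesz w (Poly_Mapping.single \<alpha> r) = r * w \<alpha>"
  by (subst riesz_superset[of "{\<alpha>}"]) auto

lemma riesz_cst_mult: "riesz w (cst r * p) = r * riesz w p"
  unfolding cst_def by (rule riesz_scale)

lemma riesz_mult_single: "riesz w (h * Poly_Mapping.single \<alpha> r) = r * riesz w (h * Poly_Mapping.single \<alpha> 1)"
proof -
  have "h * Poly_Mapping.single \<alpha> r = cst r * (h * Poly_Mapping.single \<alpha> 1)"
    by (simp add: cst_def mult.left_commute mult_single)
  then show ?thesis by (simp add: riesz_cst_mult)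
qed

lemma loc_zero_iff:
  "loc_zero k h w \<longleftrightarrow> (\<forall>\<beta>\<in>loc_index k h. \<forall>\<gamma>\<in>loc_index k h. \<forall>e\<in>{1, -1}.
     0 \<le> riesz w (h * Poly_Mapping.single (\<beta> + \<gamma>) e))"
  by (auto simp: loc_zero_def loc_mat_eq loc_entries_def riesz_mult_single[of w h _ "- 1"]
      intro: antisym)

lemma loc_psd_iff:
  "loc_psd k g w \<longleftrightarrow> (\<forall>p. keys p \<subseteq> loc_index k g \<longrightarrow> 0 \<le> riesz w (g * p\<^sup>2))"
proof
  assume psd: "loc_psd k g w"
  show "\<forall>p. keys p \<subseteq> loc_index k g \<longrightarrow> 0 \<le> riesz w (g * p\<^sup>2)"
    using psd by (auto simp: riesz_mult_square loc_psd_def loc_mat_eq)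
next
  assume *: "\<forall>p. keys p \<subseteq> loc_index k g \<longrightarrow> 0 \<le> riesz w (g * p\<^sup>2)"
  show "loc_psd k g w"
    unfolding loc_psd_def
  proof
    fix v :: "'a expo \<Rightarrow> real"
    let ?J = "loc_index k g"
    define p where "p = (\<Sum>\<beta>\<in>?J. Poly_Mapping.single \<beta> (v \<beta>))"
    have "lookup p \<gamma> = (\<Sum>\<beta>\<in>?J. if \<beta> = \<gamma> then v \<beta> else 0)" for \<gamma>
      unfolding p_def lookup_sum by (intro sum.cong) (auto simp: lookup_single when_def)
    then have p: "lookup p \<gamma> = (if \<gamma> \<in> ?J then v \<gamma> else 0)" for \<gamma> by simp
    then have keys: "keys p \<subseteq> ?J" by (metis in_keys_iff subsetI)
    have "0 \<le> riesz w (g * p\<^sup>2)" using * keys by blast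
    then show "0 \<le> (\<Sum>\<beta>\<in>?J. \<Sum>\<gamma>\<in>?J. v \<beta> * loc_mat k g w (\<beta>, \<gamma>) * v \<gamma>)"
      by (simp add: riesz_mult_square[OF keys] loc_mat_eq p cong: sum.cong)
  qed
qed

lemma test_polys_iff:
  "(\<forall>f\<in>test_polys k H G. 0 \<le> riesz w f) \<longleftrightarrow>
    (\<forall>h\<in>H. loc_zero k h w) \<and> (\<forall>g\<in>G. loc_psd k g w) \<and> loc_psd k 1 w"
proof -
  have "(\<forall>f\<in>{h * Poly_Mapping.single (\<beta> + \<gamma>) e | h \<beta> \<gamma> e.
       h \<in> H \<and> \<beta> \<in> loc_index k h \<and> \<gamma> \<in> loc_index k h \<and> e \<in> {1, -1}}. 0 \<le> riesz w f) \<longleftrightarrow>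
     (\<forall>h\<in>H. loc_zero k h w)"
    unfolding loc_zero_iff by (simp only: Ball_def mem_Collect_eq) metis
  moreover have "(\<forall>f\<in>{g * p\<^sup>2 | g p. g \<in> insert 1 G \<and> keys p \<subseteq> loc_index k g}. 0 \<le> riesz w f) \<longleftrightarrow>
     (\<forall>g\<in>insert 1 G. loc_psd k g w)"
    unfolding loc_psd_iff by (simp only: Ball_def mem_Collect_eq) metis
  ultimately show ?thesis unfolding test_polys_def ball_Un by auto
qed

lemma relaxation_iff:
  "y \<in> relaxation c E I A k \<longleftrightarrow> y \<in> A \<rightarrow>\<^sub>E UNIV \<and>
    (\<exists>w \<in> expos_upto (2 * k) \<rightarrow>\<^sub>E UNIV. (\<forall>\<alpha>\<in>A. w (hom_expo (set_deg A) \<alpha>) = y \<alpha>) \<and>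
      (\<forall>f\<in>test_polys k (hom_eqs c E) (hom_ineqs c I). 0 \<le> riesz w f))"
  unfolding test_polys_iff relaxation_def hom_eqs_def hom_ineqs_def by auto

lemma test_polys_degree:
  assumes "f \<in> test_polys k H G"
  shows "pdeg f \<le> 2 * k"
  using assms unfolding test_polys_def
proof (elim UnE CollectE exE conjE)
  fix h \<beta> \<gamma> and e :: real
  assume f: "f = h * Poly_Mapping.single (\<beta> + \<gamma>) e" and J: "\<beta> \<in> loc_index k h" "\<gamma> \<in> loc_index k h"
  have "pdeg (Poly_Mapping.single (\<beta> + \<gamma>) e) \<le> mdeg \<beta> + mdeg \<gamma>"
    by (auto simp: pdeg_le_iff mdeg_add)
  then show ?thesis
    using J pdeg_mult_le[of h "Poly_Mapping.single (\<beta> + \<gamma>) e"] unfolding f by (auto simp: loc_index_def)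
next
  fix g p assume f: "f = g * p\<^sup>2" and p: "keys p \<subseteq> loc_index k g"
  show ?thesis
  proof (cases "g = 0 \<or> p = 0")
    case True
    then show ?thesis by (auto simp: f)
  next
    case False
    then show ?thesis using p by (simp add: f pdeg_mult_square_le_iff)
  qed
qed

lemma test_polys_nonneg:
  assumes "f \<in> test_polys k H G" "\<And>h. h \<in> H \<Longrightarrow> peval h x = 0" "\<And>g. g \<in> G \<Longrightarrow> 0 \<le> peval g x"
  shows "0 \<le> peval f x"
  using assms unfolding test_polys_def by (auto simp: peval_mult peval_power)

text \<open>
  Every element of the quadratic module is tested by all relaxations of sufficiently high order.
\<close>

lemma qmodule_riesz_nonneg:
  assumes "a \<in> qmodule H G"
  shows "\<exists>k0. \<forall>k\<ge>k0. \<forall>w. (\<forall>f\<in>test_polys k H G. 0 \<le> riesz w f) \<longrightarrow> 0 \<le> riesz w a"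
proof -
  have squares: "\<exists>k0. \<forall>k\<ge>k0. \<forall>w. loc_psd k g w \<longrightarrow> 0 \<le> riesz w (g * s)" if "s \<in> sos"
    for g s :: "'a rpoly"
  proof -
    have "\<exists>k0. \<forall>k\<ge>k0. \<forall>w. loc_psd k g w \<longrightarrow> 0 \<le> riesz w (g * (\<Sum>q\<leftarrow>qs. q\<^sup>2))" for qs
    proof (induction qs)
      case (Cons q qs)
      then obtain k0 where k0: "\<forall>k\<ge>k0. \<forall>w. loc_psd k g w \<longrightarrow> 0 \<le> riesz w (g * (\<Sum>q\<leftarrow>qs. q\<^sup>2))"
        by blast
      have "keys q \<subseteq> loc_index k g" if "pdeg g + pdeg q \<le> k" for k
        using that by (auto simp: loc_index_def dest!: mdeg_le_pdeg)
      then have "0 \<le> riesz w (g * (\<Sum>q\<leftarrow>q # qs. q\<^sup>2))"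
        if "max k0 (pdeg g + pdeg q) \<le> k" "loc_psd k g w" for k w
        using that k0 by (auto simp: distrib_left riesz_add loc_psd_iff)
      then show ?case by blast
    qed auto
    then show ?thesis using that by (auto simp: sos_def)
  qed
  show ?thesis
    using assms unfolding test_polys_iff
  proof induction
    case (qmodule_sos s)
    then show ?case using squares[of s 1] by (simp only: mult_1_left) blast
  next
    case (qmodule_gen g s)
    then show ?case using squares[of s g] by blast
  next
    case (qmodule_ideal h u)
    have "riesz w (h * u) = 0" if "pdeg h + pdeg u \<le> k" "loc_zero k h w" for k w
    proof -
      have "riesz w (h * Poly_Mapping.single \<alpha> r) = 0" if \<alpha>: "\<alpha> \<in> keys u" for \<alpha> r
      proof -
        \<comment> \<open>For \<open>k \<ge> deg h + deg u\<close> the exponent \<open>\<alpha>\<close> itself is a row label, and column \<open>0\<close> suffices.\<close>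
        have "\<alpha> \<in> loc_index k h" "0 \<in> loc_index k h"
          using mdeg_le_pdeg[OF \<alpha>] \<open>pdeg h + pdeg u \<le> k\<close> by (auto simp: loc_index_def mdeg_def)
        then have "loc_entries k h w (\<alpha>, 0) = 0"
          using \<open>loc_zero k h w\<close> by (simp add: loc_zero_def loc_mat_eq)
        then show ?thesis
          using \<open>\<alpha> \<in> loc_index k h\<close> \<open>0 \<in> loc_index k h\<close>
          by (simp add: loc_entries_def riesz_mult_single[of w h _ r])
      qed
      then have "(\<Sum>\<alpha>\<in>keys u. riesz w (h * Poly_Mapping.single \<alpha> (lookup u \<alpha>))) = 0"
        by simp
      then show ?thesis
        by (subst poly_sum_monomials[OF finite_keys subset_refl, of u])
          (simp add: sum_distrib_left riesz_sum)
    qed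
    then show ?case using qmodule_ideal by (metis order_refl)
  next
    case (qmodule_add a b)
    then obtain k0 k1 where
      "\<forall>k\<ge>k0. \<forall>w. (\<forall>h\<in>H. loc_zero k h w) \<and> (\<forall>g\<in>G. loc_psd k g w) \<and> loc_psd k 1 w \<longrightarrow> 0 \<le> riesz w a"
      "\<forall>k\<ge>k1. \<forall>w. (\<forall>h\<in>H. loc_zero k h w) \<and> (\<forall>g\<in>G. loc_psd k g w) \<and> loc_psd k 1 w \<longrightarrow> 0 \<le> riesz w b"
      by blast
    then show ?case by (intro exI[of _ "max k0 k1"]) (auto simp: riesz_add)
  qed
qed

lemma riesz_homogenize_at:
  assumes "finite A" "keys p \<subseteq> A"
  shows "riesz w (homogenize_at d p) = (\<Sum>\<alpha>\<in>A. lookup p \<alpha> * w (hom_expo d \<alpha>))"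
  unfolding homogenize_at_superset[OF assms] by (simp add: riesz_sum riesz_single)


section \<open>Moments as values of feasible vectors\<close>

lemma continuous_on_hom_vec: "continuous_on S hom_vec"
proof -
  have "continuous_on S (\<lambda>x. case v of None \<Rightarrow> 1 | Some i \<Rightarrow> x $ i)" for v
    by (cases v) (auto intro!: continuous_intros)
  then have "continuous_on S (\<lambda>x. \<chi> v. case v of None \<Rightarrow> 1 | Some i \<Rightarrow> x $ i)"
    by (rule continuous_on_vec_lambda)
  then show ?thesis by (simp add: hom_vec_def[abs_def])
qed

lemma continuous_on_sphere_point: "continuous_on S sphere_point"
proof -
  have "continuous_on S (\<lambda>x. (1 / norm (hom_vec x)) *\<^sub>R hom_vec x)"
    using norm_hom_vec_pos by (intro continuous_intros continuous_on_hom_vec) (auto simp: less_le)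
  then show ?thesis by (simp add: sphere_point_def[abs_def])
qed

lemma abs_monom_eval_le_one:
  assumes "norm x = 1"
  shows "\<bar>monom_eval \<beta> x\<bar> \<le> 1"
  unfolding monom_eval_def abs_prod
  using component_le_norm_cart[of x] assms
  by (intro prod_le_1) (auto simp: power_abs intro!: power_le_one)

lemma mdeg_hom_expo: "mdeg \<alpha> \<le> d \<Longrightarrow> mdeg (hom_expo d \<alpha>) = d"
  by (simp add: mdeg_def UNIV_option_conv sum.reindex)

lemma monom_eval_sphere_point:
  assumes "mdeg \<alpha> \<le> d"
  shows "monom_eval (hom_expo d \<alpha>) (sphere_point x) * norm (hom_vec x) ^ d = monom_eval \<alpha> x"
proof -
  have "pdeg (Poly_Mapping.single \<alpha> 1 :: 'a rpoly) \<le> d" using assms by (auto simp: pdeg_le_iff)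
  then have "monom_eval (hom_expo d \<alpha>) (sphere_point x) = (1 / norm (hom_vec x)) ^ d * monom_eval \<alpha> x"
    using peval_homogenize_at_affine[of "Poly_Mapping.single \<alpha> 1" d "sphere_point x"]
      sphere_point_None_pos[of x]
    by (simp add: homogenize_at_single peval_single sphere_point_None)
  then show ?thesis using norm_hom_vec_pos[of x] by (simp add: power_divide)
qed

text \<open>
  The vector \<open>w\<close> consists of the moments of the image of \<open>|(1, x)|\<^sup>d d\<mu>(x)\<close> on the sphere. The
  polynomial \<open>q\<close> dominates the density, which makes this measure finite and bounds its mass.
\<close>

lemma moment_vector_lift:
  assumes A: "finite A" and q: "q \<in> polys_on A"
    and pos: "0 < \<delta>" "\<And>z. z \<in> hom_set c E I \<Longrightarrow> norm z = 1 \<Longrightarrow> \<delta> \<le> peval (homogenize_at (set_deg A) q) z"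
    and k: "set_deg A \<le> 2 * k"
    and y: "y \<in> moment_cone A (semialg c E I)"
  shows "\<exists>w \<in> expos_upto (2 * k) \<rightarrow>\<^sub>E UNIV. (\<forall>\<alpha>\<in>A. w (hom_expo (set_deg A) \<alpha>) = y \<alpha>) \<and>
      (\<forall>f\<in>test_polys k (hom_eqs c E) (hom_ineqs c I). 0 \<le> riesz w f) \<and>
      (\<forall>\<beta>\<in>expos_upto (2 * k). \<bar>w \<beta>\<bar> \<le> (\<Sum>\<alpha>\<in>A. lookup q \<alpha> * y \<alpha>) / \<delta>)"
proof -
  let ?K = "semialg c E I" and ?L = "\<Sum>\<alpha>\<in>A. lookup q \<alpha> * y \<alpha>"
  define d where "d = set_deg A"
  define N where "N x = norm (hom_vec x) ^ d" for x :: "real ^ 'a"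
  obtain M :: "(real ^ 'a) measure" where M: "sets M = sets borel" "measure_support M \<subseteq> ?K"
    "\<And>\<alpha>. \<alpha> \<in> A \<Longrightarrow> has_bochner_integral M (monom_eval \<alpha>) (y \<alpha>)"
    using y by (auto simp: moment_cone_def)
  have AE_K: "AE x in M. x \<in> ?K"
    using AE_measure_support[OF M(1)] M(2) by (auto elim!: eventually_mono)
  have q_keys: "keys q \<subseteq> A" and q_deg: "pdeg q \<le> d"
    using q A by (auto simp: polys_on_def pdeg_le_iff d_def intro: mdeg_le_set_deg)
  have "has_bochner_integral M (\<lambda>x. (\<Sum>\<alpha>\<in>A. lookup q \<alpha> * monom_eval \<alpha> x) / \<delta>) (?L / \<delta>)"
    by (intro has_bochner_integral_divide_zero has_bochner_integral_sum has_bochner_integral_mult_right M(3))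
  then have q_int: "has_bochner_integral M (\<lambda>x. peval q x / \<delta>) (?L / \<delta>)"
    by (simp add: peval_superset[OF A q_keys])
  have N_le: "N x \<le> peval q x / \<delta>" if x: "x \<in> ?K" for x
  proof -
    have "\<delta> \<le> peval (homogenize_at d q) (sphere_point x)"
      unfolding d_def by (intro pos(2) sphere_point_in_hom_set x) simp
    also have "\<dots> = (1 / norm (hom_vec x)) ^ d * peval q x"
      using sphere_point_None_pos[of x]
      by (simp add: peval_homogenize_at_affine[OF q_deg] sphere_point_None)
    finally show ?thesis
      using norm_hom_vec_pos[of x] pos(1) by (simp add: N_def power_divide field_simps)
  qed
  have N_nonneg: "0 \<le> N x" for x by (simp add: N_def)
  have bound: "\<bar>monom_eval \<beta> (sphere_point x) * N x\<bar> \<le> peval q x / \<delta>" if "x \<in> ?K" for \<beta> x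
  proof -
    have "\<bar>monom_eval \<beta> (sphere_point x) * N x\<bar> \<le> 1 * N x"
      unfolding abs_mult using abs_monom_eval_le_one[of "sphere_point x" \<beta>] N_nonneg[of x]
      by (intro mult_mono) auto
    then show ?thesis using N_le[OF that] by simp
  qed
  have meas: "(\<lambda>x. monom_eval \<beta> (sphere_point x) * N x) \<in> borel_measurable M" for \<beta>
  proof -
    have "continuous_on UNIV (\<lambda>x. monom_eval \<beta> (sphere_point x) * N x)"
      unfolding N_def
      by (intro continuous_intros continuous_on_hom_vec
          continuous_on_compose2[OF continuous_on_monom_eval[of UNIV] continuous_on_sphere_point]) auto
    then show ?thesis
      using borel_measurable_continuous_onI measurable_cong_sets[OF M(1) refl] by blast
  qed
  have int: "integrable M (\<lambda>x. monom_eval \<beta> (sphere_point x) * N x)" for \<beta>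
  proof (rule Bochner_Integration.integrable_bound)
    show "integrable M (\<lambda>x. peval q x / \<delta>)" using q_int by (simp add: has_bochner_integral_iff)
    show "AE x in M. norm (monom_eval \<beta> (sphere_point x) * N x) \<le> norm (peval q x / \<delta>)"
      using AE_K
    proof (rule eventually_mono)
      fix x assume "x \<in> ?K"
      then show "norm (monom_eval \<beta> (sphere_point x) * N x) \<le> norm (peval q x / \<delta>)"
        using bound[of x \<beta>] unfolding real_norm_def by linarith
    qed
  qed (rule meas)
  define w where "w = (\<lambda>\<beta>\<in>expos_upto (2 * k). \<integral>x. monom_eval \<beta> (sphere_point x) * N x \<partial>M)"
  have riesz_w: "riesz w f = (\<integral>x. peval f (sphere_point x) * N x \<partial>M)" if f: "pdeg f \<le> 2 * k" for f
  proof -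
    have "riesz w f = (\<Sum>\<beta>\<in>keys f. \<integral>x. lookup f \<beta> * (monom_eval \<beta> (sphere_point x) * N x) \<partial>M)"
      unfolding riesz_def using f
      by (intro sum.cong) (auto simp: w_def expos_upto_def pdeg_le_iff)
    also have "\<dots> = (\<integral>x. (\<Sum>\<beta>\<in>keys f. lookup f \<beta> * (monom_eval \<beta> (sphere_point x) * N x)) \<partial>M)"
      using int by (intro Bochner_Integration.integral_sum[symmetric]) auto
    also have "\<dots> = (\<integral>x. peval f (sphere_point x) * N x \<partial>M)"
      by (simp add: peval_def sum_distrib_right mult.assoc)
    finally show ?thesis .
  qed
  show ?thesis
  proof (intro bexI[of _ w] conjI ballI)
    fix \<alpha> assume \<alpha>: "\<alpha> \<in> A"
    then have \<alpha>_deg: "mdeg \<alpha> \<le> d" unfolding d_def by (rule mdeg_le_set_deg[OF A])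
    then have "hom_expo d \<alpha> \<in> expos_upto (2 * k)"
      using k by (simp add: expos_upto_def mdeg_hom_expo d_def)
    then have "w (hom_expo d \<alpha>) = (\<integral>x. monom_eval \<alpha> x \<partial>M)"
      by (simp add: w_def N_def monom_eval_sphere_point[OF \<alpha>_deg])
    then show "w (hom_expo (set_deg A) \<alpha>) = y \<alpha>"
      using M(3)[OF \<alpha>] by (simp add: d_def has_bochner_integral_iff)
  next
    fix f assume f: "f \<in> test_polys k (hom_eqs c E) (hom_ineqs c I)"
    have "0 \<le> peval f (sphere_point x) * N x" if "x \<in> ?K" for x
      using sphere_point_in_hom_set[OF that] hom_constraints_iff[of c E "sphere_point x" I]
      by (intro mult_nonneg_nonneg N_nonneg test_polys_nonneg[OF f]) auto
    then have "AE x in M. 0 \<le> peval f (sphere_point x) * N x"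
      using AE_K by (auto elim!: eventually_mono)
    then show "0 \<le> riesz w f"
      unfolding riesz_w[OF test_polys_degree[OF f]] by (rule integral_nonneg_AE)
  next
    fix \<beta> :: "'a option expo" assume \<beta>: "\<beta> \<in> expos_upto (2 * k)"
    have "\<bar>w \<beta>\<bar> \<le> (\<integral>x. \<bar>monom_eval \<beta> (sphere_point x) * N x\<bar> \<partial>M)"
      using \<beta> integral_abs_bound by (simp add: w_def)
    also have "\<dots> \<le> (\<integral>x. peval q x / \<delta> \<partial>M)"
    proof (rule integral_mono_AE)
      show "AE x in M. \<bar>monom_eval \<beta> (sphere_point x) * N x\<bar> \<le> peval q x / \<delta>"
        using AE_K by (rule eventually_mono) (rule bound)
    qed (use int q_int in \<open>auto simp: has_bochner_integral_iff\<close>)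
    also have "\<dots> = ?L / \<delta>" using q_int by (simp add: has_bochner_integral_iff)
    finally show "\<bar>w \<beta>\<bar> \<le> ?L / \<delta>" .
  qed (simp add: w_def)
qed

text \<open>
  Near a point of the closure the lifted vectors stay in a compact box, so the projection of the
  feasible vectors in this box is closed.
\<close>

lemma closure_moment_cone_subset_relaxation:
  fixes c :: "'l \<Rightarrow> 'n::finite rpoly"
  assumes A: "finite A" and q: "q \<in> polys_on A"
    and pos: "0 < \<delta>" "\<And>z. z \<in> hom_set c E I \<Longrightarrow> norm z = 1 \<Longrightarrow> \<delta> \<le> peval (homogenize_at (set_deg A) q) z"
    and k: "set_deg A \<le> 2 * k"
  shows "product_topology (\<lambda>_. euclideanreal) A closure_of moment_cone A (semialg c E I)
    \<subseteq> relaxation c E I A k"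
proof
  define X where "X = product_topology (\<lambda>_::'n expo. euclideanreal) A"
  define J where "J = (expos_upto (2 * k) :: 'n option expo set)"
  define Y where "Y = product_topology (\<lambda>_::'n option expo. euclideanreal) J"
  define L where "L y = (\<Sum>\<alpha>\<in>A. lookup q \<alpha> * y \<alpha>)" for y :: "'n expo \<Rightarrow> real"
  define F where "F = test_polys k (hom_eqs c E) (hom_ineqs c I)"
  have topX: "topspace X = A \<rightarrow>\<^sub>E UNIV" and topY: "topspace Y = J \<rightarrow>\<^sub>E UNIV"
    by (simp_all add: X_def Y_def)
  fix y assume "y \<in> product_topology (\<lambda>_. euclideanreal) A closure_of moment_cone A (semialg c E I)"
  then have y: "y \<in> X closure_of moment_cone A (semialg c E I)" by (simp add: X_def)
  then have yX: "y \<in> topspace X" by (rule subsetD[OF closure_of_subset_topspace])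
  define B where "B = (L y + 1) / \<delta>"
  define W where "W = (J \<rightarrow>\<^sub>E {-B..B}) \<inter> {w \<in> topspace Y. \<forall>f\<in>F. 0 \<le> riesz w f}"
  have "closedin Y {w \<in> topspace Y. 0 \<le> riesz w f}" if f: "f \<in> F" for f
  proof -
    have "keys f \<subseteq> J"
      using test_polys_degree[OF f[unfolded F_def]] by (auto simp: J_def expos_upto_def pdeg_le_iff)
    then have "continuous_map Y euclideanreal (\<lambda>w. riesz w f)"
      unfolding riesz_def Y_def by (intro continuous_intros) auto
    then have "closedin Y {w \<in> topspace Y. riesz w f \<in> {0..}}"
      by (rule closedin_continuous_map_preimage) simp
    then show ?thesis by simp
  qed
  then have "closedin Y (\<Inter> (insert (topspace Y) ((\<lambda>f. {w \<in> topspace Y. 0 \<le> riesz w f}) ` F)))"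
    by (intro closedin_Inter) auto
  also have "\<Inter> (insert (topspace Y) ((\<lambda>f. {w \<in> topspace Y. 0 \<le> riesz w f}) ` F))
      = {w \<in> topspace Y. \<forall>f\<in>F. 0 \<le> riesz w f}"
    by auto
  finally have closed: "closedin Y {w \<in> topspace Y. \<forall>f\<in>F. 0 \<le> riesz w f}" .
  have "compactin Y (J \<rightarrow>\<^sub>E {-B..B})" unfolding Y_def by (simp add: compactin_PiE)
  then have "compactin Y W" unfolding W_def by (intro compact_Int_closedin closed)
  moreover define r where "r w = (\<lambda>\<alpha>\<in>A. w (hom_expo (set_deg A) \<alpha>))" for w :: "'n option expo \<Rightarrow> real"
  have J_hom: "hom_expo (set_deg A) \<alpha> \<in> J" if "\<alpha> \<in> A" for \<alpha>
    using k mdeg_le_set_deg[OF A that] by (simp add: J_def expos_upto_def mdeg_hom_expo)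
  have "continuous_map Y euclideanreal (\<lambda>w. r w \<alpha>)" if "\<alpha> \<in> A" for \<alpha>
    using that continuous_map_product_projection[OF J_hom[OF that], of "\<lambda>_. euclideanreal"]
    unfolding r_def Y_def by simp
  then have "continuous_map Y X r"
    unfolding X_def by (subst continuous_map_componentwise) (auto simp: r_def)
  ultimately have "compactin X (r ` W)" by (intro image_compactin)
  then have closed_image: "closedin X (r ` W)"
    by (intro compactin_imp_closedin) (simp add: X_def Hausdorff_space_product_topology)
  define U where "U = {z \<in> topspace X. L z \<in> {..<L y + 1}}"
  have "continuous_map X euclideanreal L"
    unfolding L_def X_def by (intro continuous_intros A) auto
  then have U: "openin X U"
    unfolding U_def by (rule openin_continuous_map_preimage) simp
  have "U \<inter> moment_cone A (semialg c E I) \<subseteq> r ` W"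
  proof
    fix z assume z: "z \<in> U \<inter> moment_cone A (semialg c E I)"
    have "\<exists>w \<in> J \<rightarrow>\<^sub>E UNIV. (\<forall>\<alpha>\<in>A. w (hom_expo (set_deg A) \<alpha>) = z \<alpha>) \<and>
        (\<forall>f\<in>F. 0 \<le> riesz w f) \<and> (\<forall>\<beta>\<in>J. \<bar>w \<beta>\<bar> \<le> L z / \<delta>)"
      unfolding J_def F_def L_def
      by (rule moment_vector_lift[OF A q pos(1) _ k IntD2[OF z]]) (rule pos(2))
    then obtain w where w: "w \<in> J \<rightarrow>\<^sub>E UNIV" "\<forall>\<alpha>\<in>A. w (hom_expo (set_deg A) \<alpha>) = z \<alpha>"
      "\<forall>f\<in>F. 0 \<le> riesz w f" "\<forall>\<beta>\<in>J. \<bar>w \<beta>\<bar> \<le> L z / \<delta>"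
      by (elim bexE conjE) blast
    have "L z / \<delta> \<le> B" using z pos(1) unfolding B_def U_def by (intro divide_right_mono) auto
    then have "w \<in> J \<rightarrow>\<^sub>E {-B..B}" using w(1,4) by (force simp: PiE_iff abs_le_iff)
    then have "w \<in> W" using w(1,3) by (simp add: W_def topY)
    moreover have "r w = z"
      using w(2) z by (auto simp: r_def moment_cone_def fun_eq_iff PiE_def extensional_def)
    ultimately show "z \<in> r ` W" by blast
  qed
  then have "X closure_of (U \<inter> moment_cone A (semialg c E I)) \<subseteq> r ` W"
    by (rule closure_of_minimal[OF _ closed_image])
  moreover have "y \<in> U" using yX by (simp add: U_def)
  ultimately have "y \<in> r ` W" using openin_Int_closure_of_subset[OF U] y by blast
  then show "y \<in> relaxation c E I A k"
    unfolding relaxation_iff by (auto simp: W_def topY r_def J_def F_def)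
qed

text \<open>
  A vector outside the closure is separated from it by a polynomial \<open>p\<close> that is nonnegative on
  \<open>K\<close>. Adding a small multiple of \<open>q\<close> makes the homogenization positive, hence a member of the
  quadratic module, and a relaxation of high order cuts the vector off.
\<close>

lemma relaxations_subset_closure_moment_cone:
  fixes c :: "'l \<Rightarrow> 'n::finite rpoly"
  assumes A: "finite A" and cl: "closed_at_infinity c E I" and q: "q \<in> polys_on A"
    and pos: "\<And>z. z \<in> hom_set c E I \<Longrightarrow> norm z = 1 \<Longrightarrow> 0 < peval (homogenize_at (set_deg A) q) z"
    and y: "\<And>k. 1 \<le> k \<Longrightarrow> set_deg A \<le> 2 * k \<Longrightarrow> y \<in> relaxation c E I A k"
  shows "y \<in> product_topology (\<lambda>_. euclideanreal) A closure_of moment_cone A (semialg c E I)"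
proof (rule ccontr)
  let ?K = "semialg c E I"
  let ?X = "product_topology (\<lambda>_::'n expo. euclideanreal) A"
  assume "y \<notin> ?X closure_of moment_cone A ?K"
  then have y_notin: "y \<notin> ?X closure_of atomic_moments A ?K"
    using closure_of_mono[OF atomic_moments_subset] by blast
  have y_ext: "y \<in> A \<rightarrow>\<^sub>E UNIV" using y[of "max 1 (set_deg A)"] by (simp add: relaxation_iff)
  obtain v where v: "\<And>z. z \<in> atomic_moments A ?K \<Longrightarrow> 0 \<le> (\<Sum>\<alpha>\<in>A. v \<alpha> * z \<alpha>)"
    "(\<Sum>\<alpha>\<in>A. v \<alpha> * y \<alpha>) < 0"
  proof (rule cone_separation[OF A _ atomic_moments_zero _ y_ext y_notin])
    show "atomic_moments A ?K \<subseteq> A \<rightarrow>\<^sub>E UNIV" by (auto simp: atomic_moments_def)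
  qed (use atomic_moments_combination in blast)+
  define p where "p = (\<Sum>\<alpha>\<in>A. Poly_Mapping.single \<alpha> (v \<alpha>))"
  have "lookup p \<beta> = (\<Sum>\<alpha>\<in>A. if \<alpha> = \<beta> then v \<alpha> else 0)" for \<beta>
    unfolding p_def lookup_sum by (intro sum.cong) (auto simp: lookup_single when_def)
  then have lookup_p: "lookup p \<beta> = (if \<beta> \<in> A then v \<beta> else 0)" for \<beta> using A by simp
  then have p_keys: "keys p \<subseteq> A" by (metis in_keys_iff subsetI)
  have q_keys: "keys q \<subseteq> A" using q by (simp add: polys_on_def)
  have p_nonneg: "0 \<le> peval p x" if "x \<in> ?K" for x
    using v(1)[OF atomic_moments_point[OF that]]
    by (simp add: peval_superset[OF A p_keys] lookup_p cong: sum.cong)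
  let ?P = "\<Sum>\<alpha>\<in>A. v \<alpha> * y \<alpha>" and ?Q = "\<Sum>\<alpha>\<in>A. lookup q \<alpha> * y \<alpha>"
  \<comment> \<open>\<open>\<epsilon>\<close> is chosen so small that \<open>p + \<epsilon> q\<close> still has a negative value on \<open>y\<close>.\<close>
  define \<epsilon> where "\<epsilon> = - ?P / (\<bar>?Q\<bar> + 1)"
  have \<epsilon>: "0 < \<epsilon>" using v(2) by (simp add: \<epsilon>_def divide_neg_pos)
  have "\<epsilon> * ?Q < \<epsilon> * (\<bar>?Q\<bar> + 1)" using \<epsilon> by (intro mult_strict_left_mono) auto
  also have "\<dots> = - ?P" unfolding \<epsilon>_def by (simp add: add_nonneg_eq_0_iff)
  finally have neg: "?P + \<epsilon> * ?Q < 0" by simp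
  define d where "d = set_deg A"
  define f where "f = p - cst (- \<epsilon>) * q"
  have f_keys: "keys f \<subseteq> A" using keys_diff_scale[of p "- \<epsilon>" q] p_keys q_keys by (auto simp: f_def)
  have p_deg: "pdeg p \<le> d"
    using p_keys A by (auto simp: pdeg_le_iff d_def intro: mdeg_le_set_deg)
  have "0 < peval (homogenize_at d f) z" if z: "z \<in> hom_set c E I" "norm z = 1" for z
  proof -
    have "0 \<le> peval (homogenize_at d p) z"
      by (rule homogenize_at_nonneg[OF cl p_deg p_nonneg z(1)])
    moreover have "0 < \<epsilon> * peval (homogenize_at d q) z" using \<epsilon> pos[OF z] by (simp add: d_def)
    ultimately show ?thesis
      by (simp add: f_def homogenize_at_diff homogenize_at_scale peval_diff peval_mult)
  qed
  then have "homogenize_at d f \<in> qmodule (hom_eqs c E) (hom_ineqs c I)"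
    by (rule positive_homogeneous_in_qmodule)
  then obtain k0 where k0: "\<And>k w. k0 \<le> k \<Longrightarrow>
      (\<forall>f\<in>test_polys k (hom_eqs c E) (hom_ineqs c I). 0 \<le> riesz w f) \<Longrightarrow>
      0 \<le> riesz w (homogenize_at d f)"
    using qmodule_riesz_nonneg by meson
  define k where "k = max k0 (max 1 d)"
  have "y \<in> relaxation c E I A k" by (rule y) (auto simp: k_def d_def)
  then obtain w where w: "\<forall>\<alpha>\<in>A. w (hom_expo d \<alpha>) = y \<alpha>"
    "\<forall>f\<in>test_polys k (hom_eqs c E) (hom_ineqs c I). 0 \<le> riesz w f"
    unfolding relaxation_iff d_def by blast
  have "0 \<le> riesz w (homogenize_at d f)" using w(2) by (intro k0[of k]) (auto simp: k_def)
  also have "\<dots> = (\<Sum>\<alpha>\<in>A. (v \<alpha> + \<epsilon> * lookup q \<alpha>) * y \<alpha>)"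
    unfolding riesz_homogenize_at[OF A f_keys] using w(1)
    by (intro sum.cong) (auto simp: f_def lookup_minus lookup_cst_mult lookup_p)
  also have "\<dots> = ?P + \<epsilon> * ?Q"
    by (simp add: distrib_right sum.distrib sum_distrib_left mult.assoc)
  finally show False using neg by simp
qed

section \<open>Convergence of the relaxations\<close>

theorem theorem3p10:
  fixes c :: "'l \<Rightarrow> 'n::finite rpoly"
    and E I :: "'l set"
    and A :: "'n expo set"
    and K :: "(real ^ 'n) set"
    and d :: nat
  assumes "finite E" and "finite I" and "finite A"
    and "K = semialg c E I"
    and "d = set_deg A"
    and "closed_at_infinity c E I"
    and "polys_on A \<inter>
      (poly_topology (polys_upto (int d)) interior_of nonneg_polys (polys_upto (int d)) K) \<noteq> {}"
  shows "(\<Inter>k\<in>{k. 1 \<le> k \<and> d \<le> 2 * k}. relaxation c E I A k) =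
      product_topology (\<lambda>_. euclideanreal) A closure_of moment_cone A K
    \<and> poly_topology (polys_on A) interior_of nonneg_polys (polys_on A) K
      \<subseteq> (\<Union>k\<in>{1..}. sos_approx c E I A k)
    \<and> (\<Union>k\<in>{1..}. sos_approx c E I A k) \<subseteq> nonneg_polys (polys_on A) K"
proof -
  note fin = assms(1-3) and K = assms(4) and d = assms(5) and cl = assms(6)
  obtain q where q: "q \<in> polys_on A" "q \<in> poly_topology (polys_upto (int (set_deg A)))
      interior_of nonneg_polys (polys_upto (int (set_deg A))) (semialg c E I)"
    using assms(7) K d by blast
  let ?q = "homogenize_at (set_deg A) q"
  have pos: "0 < peval ?q z" if "z \<in> hom_set c E I" "norm z = 1" for z
    using that by (intro homogenize_at_interior_pos[OF cl q(2)]) auto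
  have "compact (hom_set c E I \<inter> sphere 0 1)"
    by (intro closed_Int_compact closed_hom_set cl) simp
  then have "\<exists>\<delta>>0. \<forall>z\<in>hom_set c E I \<inter> sphere 0 1. \<delta> \<le> peval ?q z"
  proof (cases "hom_set c E I \<inter> sphere 0 1 = {}")
    case False
    then obtain z0 where "z0 \<in> hom_set c E I \<inter> sphere 0 1"
      "\<forall>z\<in>hom_set c E I \<inter> sphere 0 1. peval ?q z0 \<le> peval ?q z"
      using continuous_attains_inf[OF \<open>compact _\<close> _ continuous_on_peval] by blast
    then show ?thesis using pos by (intro exI[of _ "peval ?q z0"]) auto
  qed (auto intro: exI[of _ 1])
  then obtain \<delta> where \<delta>: "0 < \<delta>"
    "\<And>z. z \<in> hom_set c E I \<Longrightarrow> norm z = 1 \<Longrightarrow> \<delta> \<le> peval ?q z"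
    by auto
  have "product_topology (\<lambda>_. euclideanreal) A closure_of moment_cone A K
      \<subseteq> (\<Inter>k\<in>{k. 1 \<le> k \<and> d \<le> 2 * k}. relaxation c E I A k)"
    unfolding K d
    by (intro INT_greatest closure_moment_cone_subset_relaxation[OF fin(3) q(1) \<delta>]) auto
  moreover have "(\<Inter>k\<in>{k. 1 \<le> k \<and> d \<le> 2 * k}. relaxation c E I A k)
      \<subseteq> product_topology (\<lambda>_. euclideanreal) A closure_of moment_cone A K"
    unfolding K d
    by (intro subsetI relaxations_subset_closure_moment_cone[OF fin(3) cl q(1) pos]) auto
  moreover have "poly_topology (polys_on A) interior_of nonneg_polys (polys_on A) K
      \<subseteq> (\<Union>k\<in>{1..}. sos_approx c E I A k)"
    unfolding K using interior_subset_sos_approx[OF fin cl q] by fastforce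
  moreover have "(\<Union>k\<in>{1..}. sos_approx c E I A k) \<subseteq> nonneg_polys (polys_on A) K"
    unfolding K using sos_approx_subset by blast
  ultimately show ?thesis by blast
qed

end
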